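(* Let $r\ge 0$. Every arithmetic partial differential operator of order at most $r$ is also analytic of level $r$. Specifically, let $\mathcal{A}\subset A_\pi$ be a collection of centers of balls of radius $1/\pi^r$ covering $A_\pi$ (so that every $v\in A_\pi$ can be written uniquely as $v=a+\pi^r u$ with $a\in\mathcal{A}$, $u\in A_\pi$), and let $F\in\Gamma$. For $a\in\mathcal{A}$ let $\tau_a\colon\Gamma\to\Gamma$ be the $A_\pi$-algebra homomorphism (substitution into restricted power series) induced by $$\tau_a(x_\mu):=\sum_{j\in J_\mu}c_a(j,\mu)\prod_{\nu\in\mathcal{P}_\mu}x_\nu^{j(\nu)},\qquad \mu\in\mathbb{M}^r .$$ Then $\Delta(F)=\Phi^{\oplus\mathcal{A}}\big((\tau_a(F))_{a\in\mathcal{A}}\big)$.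
   Context: Fix a prime $p$. Let $\pi$ be a root, in a fixed algebraic closure of $\mathbf{Q}_p$, of an Eisenstein polynomial over $\mathbf{Z}_p$ such that $\mathbf{Q}_p(\pi)/\mathbf{Q}_p$ is Galois, and let $A_\pi=\mathbf{Z}_p[\pi]$ be the ring of integers of $\mathbf{Q}_p(\pi)$. Fix ring homomorphisms $\phi_1,\ldots,\phi_n\colon A_\pi\to A_\pi$ that are restrictions of Frobenius automorphisms (continuous elements of $\mathrm{Gal}(K^{\mathrm{alg}}/\mathbf{Q}_p)$ inducing the $p$-power Frobenius on the residue field, where $K$ is the completion of the maximal unramified extension of $\mathbf{Q}_p$); in particular $\phi_i(a)\equiv a^p\bmod\pi$. Put $\delta_i(a)=(\phi_i(a)-a^p)/\pi$. $\mathbb{M}$ is the free non-commutative monoid of words on $\{1,\ldots,n\}$ under concatenation, with empty word $0$; $|\mu|$ is the length of $\mu$, and $\mathbb{M}^r$ is the set of words of length at most $r$. For $\mu=i_1\cdots i_s$ put $\phi_\mu=\phi_{i_1}\circ\cdots\circ\phi_{i_s}$, $\delta_\mu=\delta_{i_1}\circ\cdots\circ\delta_{i_s}$ (identity for the empty word). A word $\nu=j_1\cdots j_t$ is a subword of $\mu=i_1\cdots i_s$ (written $\nu\le\mu$) if there are $k_1<\cdots<k_t$ with $j_\ell=i_{k_\ell}$ for all $\ell$. $\mathbf{N}$ is the set of non-negative integers. $\Gamma$ is the ring of restricted power series (coefficients tending to $0$ $\pi$-adically) over $A_\pi$ in the variables $x_\mu$, $\mu\in\mathbb{M}^r$. For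 $G\in\Gamma$ define functions $A_\pi\to A_\pi$ by $\Delta(G)(v)=G(\delta_\mu(v):\mu\in\mathbb{M}^r)$ and $\Phi(G)(v)=G(\phi_\mu(v):\mu\in\mathbb{M}^r)$. For $(F_a)_{a\in\mathcal{A}}\in\Gamma^{\oplus\mathcal{A}}$, $\Phi^{\oplus\mathcal{A}}((F_a)_a)$ is the function $A_\pi\to A_\pi$ given by $a+\pi^r u\mapsto\Phi(F_a)(u)$ for $a\in\mathcal{A}$, $u\in A_\pi$. A function $f\colon A_\pi\to A_\pi$ is an arithmetic partial differential operator of order at most $r$ if $f=\Delta(G)$ for some $G\in\Gamma$. It is analytic of level $r$ if for every $a\in A_\pi$ there is $F_a\in\Gamma$ with $f(a+\pi^ru)=\Phi(F_a)(u)$ for all $u\in A_\pi$. For $\mu\in\mathbb{M}^r$: $\mathcal{P}_\mu=\{\nu\in\mathbb{M}^r:\nu\le\mu\}$; for $j\colon\mathcal{P}_\mu\to\mathbf{N}$, $|j|_1=\sum_\nu j(\nu)$; $j_\mu\colon\mathcal{P}_\mu\to\mathbf{N}$ is the indicator function of $\mu$; and $J_\mu=\{j\colon\mathcal{P}_\mu\to\mathbf{N}\mid j(\mu)=0,\ |j|_1\le p^{|\mu|}\}\cup\{j_\mu\}$. For each $a\in A_\pi$ and $\mu\in\mathbb{M}^r$ there exist, and one fixes, elements $c_a(j,\mu)\in A_\pi$ ($j\in J_\mu$) such that for all $u\in A_\pi$ $$\delta_\mu(a+\pi^r u)=\sum_{j\in J_\mu}c_a(j,\mu)\prod_{\nu\in\mathcal{P}_\mu}\phi_\nu(u)^{j(\nu)}.$$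 (These are the coefficients obtained by recursively expanding $\delta_{i\cdot\mu}=\pi^{-1}(\phi_i\circ\delta_\mu-\delta_\mu^{\,p})$.) *)

theory Defs
  imports
    "HOL-Algebra.Algebraic_Closure_Type"
    "HOL-Algebra.Generated_Fields"
    "HOL-Library.Sublist"
    "HOL-Library.Poly_Mapping"
    "HOL-Analysis.Analysis"
begin

section \<open>The ambient valued field\<close>

text \<open>The type variable of the statement carries an algebraically closed non-archimedean valued
  field, which \<open>is_K_alg\<close> below identifies with the algebraic closure of the completed maximal
  unramified extension of the p-adic numbers. The fields \<open>Qp\<close>, its maximal unramified
  extension, the completion \<open>K\<close> of the latter and (all finite extensions inside) the algebraic
  closure of \<open>Qp\<close> are subsets of this one type. All topological notions are those of the metric
  given by the absolute value.\<close>

class nonarch_field = field_char_0 + metric_space +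
  fixes absv :: "'a \<Rightarrow> real"
  assumes dist_absv: "dist x y = absv (x - y)"
    and absv_mult: "absv (x * y) = absv x * absv y"
    and absv_add: "absv (x + y) \<le> max (absv x) (absv y)"

abbreviation ring_on :: "'a::comm_ring_1 set \<Rightarrow> 'a ring"
  where "ring_on S \<equiv> ring_of_type_algebra\<lparr>carrier := S\<rparr>"

text \<open>When the absolute value restricts to the p-adic one on the rationals and \<open>Qp\<close> is complete
  (both are part of \<open>is_K_alg\<close>), this is the completion of the rationals, that is, the field of
  p-adic numbers.\<close>

definition Qp :: "'a::nonarch_field set"
  where "Qp = closure \<rat>"

definition Zp :: "'a::nonarch_field set"
  where "Zp = {x \<in> Qp. absv x \<le> 1}"

text \<open>A finite extension is unramified if \<open>p\<close> generates the maximal ideal of its ring of integers;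
  the residue field extension is automatically separable because the prime field is perfect.\<close>

definition unramified_ext :: "nat \<Rightarrow> 'a::nonarch_field set \<Rightarrow> bool"
  where "unramified_ext p L \<longleftrightarrow>
    subfield L ring_of_type_algebra \<and> Qp \<subseteq> L \<and>
    ring.finite_dimension ring_of_type_algebra Qp L \<and>
    {x \<in> L. absv x < 1} = (\<lambda>x. of_nat p * x) ` {x \<in> L. absv x \<le> 1}"

definition max_unramified :: "nat \<Rightarrow> 'a::nonarch_field set"
  where "max_unramified p = \<Union> {L. unramified_ext p L}"

definition completed_unramified :: "nat \<Rightarrow> 'a::nonarch_field set"
  where "completed_unramified p = closure (max_unramified p)"

definition algebraic_over :: "'a::field set \<Rightarrow> 'a \<Rightarrow> bool"
  where "algebraic_over F x \<longleftrightarrow> (\<exists>q. q \<noteq> 0 \<and> (\<forall>i. Polynomial.coeff q i \<in> F) \<and> poly q x = 0)"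

definition is_K_alg :: "nat \<Rightarrow> 'a::{nonarch_field, alg_closed_field} itself \<Rightarrow> bool"
  where "is_K_alg p T \<longleftrightarrow>
    absv (of_nat p :: 'a) = 1 / real p \<and>
    complete (Qp :: 'a set) \<and>
    complete (completed_unramified p :: 'a set) \<and>
    (\<forall>x :: 'a. algebraic_over (completed_unramified p) x)"


section \<open>Galois theory and the ring \<open>A\<close>\<close>

definition Gal :: "'a::field set \<Rightarrow> 'a set \<Rightarrow> ('a \<Rightarrow> 'a) set"
  where "Gal L F = {\<sigma> \<in> ring_iso (ring_on L) (ring_on L). \<forall>x\<in>F. \<sigma> x = x}"

definition galois_ext :: "'a::field set \<Rightarrow> 'a set \<Rightarrow> bool"
  where "galois_ext L F \<longleftrightarrow>
    (\<forall>x\<in>L. algebraic_over F x) \<and> {x \<in> L. \<forall>\<sigma>\<in>Gal L F. \<sigma> x = x} = F"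

definition eisenstein :: "nat \<Rightarrow> 'a::nonarch_field poly \<Rightarrow> bool"
  where "eisenstein p E \<longleftrightarrow>
    Polynomial.degree E > 0 \<and>
    (\<forall>i. Polynomial.coeff E i \<in> Zp) \<and>
    Polynomial.lead_coeff E \<notin> (\<lambda>x. of_nat p * x) ` Zp \<and>
    (\<forall>i < Polynomial.degree E. Polynomial.coeff E i \<in> (\<lambda>x. of_nat p * x) ` Zp) \<and>
    Polynomial.coeff E 0 \<notin> (\<lambda>x. of_nat p ^ 2 * x) ` Zp"

definition Api :: "'a::nonarch_field \<Rightarrow> 'a set"
  where "Api \<pi> = {poly q \<pi> |q. \<forall>i. Polynomial.coeff q i \<in> Zp}"

definition frobenius_aut :: "nat \<Rightarrow> ('a::nonarch_field \<Rightarrow> 'a) \<Rightarrow> bool"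
  where "frobenius_aut p \<sigma> \<longleftrightarrow>
    \<sigma> \<in> Gal UNIV Qp \<and> continuous_on UNIV \<sigma> \<and>
    (\<forall>x. absv x \<le> 1 \<longrightarrow> absv (\<sigma> x) \<le> 1 \<and> absv (\<sigma> x - x ^ p) < 1)"


section \<open>Words\<close>

definition words :: "nat \<Rightarrow> nat \<Rightarrow> nat list set"
  where "words n r = {\<mu>. set \<mu> \<subseteq> {1..n} \<and> length \<mu> \<le> r}"

definition subwords :: "nat \<Rightarrow> nat \<Rightarrow> nat list \<Rightarrow> nat list set"
  where "subwords n r \<mu> = {\<nu> \<in> words n r. subseq \<nu> \<mu>}"

definition delta1 :: "nat \<Rightarrow> 'a::field \<Rightarrow> (nat \<Rightarrow> 'a \<Rightarrow> 'a) \<Rightarrow> nat \<Rightarrow> 'a \<Rightarrow> 'a"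
  where "delta1 p \<pi> \<phi> i a = (\<phi> i a - a ^ p) / \<pi>"

text \<open>\<open>foldr f [i, j, k] v = f i (f j (f k v))\<close>\<close>

definition phi_word :: "(nat \<Rightarrow> 'a \<Rightarrow> 'a) \<Rightarrow> nat list \<Rightarrow> 'a \<Rightarrow> 'a"
  where "phi_word \<phi> \<mu> v = foldr \<phi> \<mu> v"

definition delta_word :: "nat \<Rightarrow> 'a::field \<Rightarrow> (nat \<Rightarrow> 'a \<Rightarrow> 'a) \<Rightarrow> nat list \<Rightarrow> 'a \<Rightarrow> 'a"
  where "delta_word p \<pi> \<phi> \<mu> v = foldr (delta1 p \<pi> \<phi>) \<mu> v"


section \<open>Restricted power series\<close>

text \<open>A monomial in the variables indexed by words is a finitely supported exponent function, and a
  power series is its coefficient function on monomials.\<close>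

type_synonym mon = "nat list \<Rightarrow>\<^sub>0 nat"
type_synonym 'a series = "mon \<Rightarrow> 'a"

definition const_series :: "'a::zero \<Rightarrow> 'a series"
  where "const_series c = (\<lambda>m. if m = 0 then c else 0)"

definition var_series :: "nat list \<Rightarrow> 'a::zero_neq_one series"
  where "var_series \<mu> = (\<lambda>m. if m = Poly_Mapping.single \<mu> 1 then 1 else 0)"

definition restricted_ring :: "'a::nonarch_field \<Rightarrow> nat \<Rightarrow> nat \<Rightarrow> 'a series ring"
  where "restricted_ring \<pi> n r = \<lparr>
    carrier = {F. (\<forall>m. F m \<in> Api \<pi>) \<and>
                  (\<forall>m. F m \<noteq> 0 \<longrightarrow> Poly_Mapping.keys m \<subseteq> words n r) \<and>
                  (\<forall>k. finite {m. F m \<notin> (\<lambda>x. \<pi> ^ k * x) ` Api \<pi>})},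
    monoid.mult = (\<lambda>F G m. \<Sum>(k, l) | k + l = m. F k * G l),
    one = const_series 1,
    ring.zero = const_series 0,
    add = (\<lambda>F G m. F m + G m)\<rparr>"

definition restricted_alg_hom ::
    "'a::nonarch_field \<Rightarrow> nat \<Rightarrow> nat \<Rightarrow> ('a series \<Rightarrow> 'a series) \<Rightarrow> bool"
  where "restricted_alg_hom \<pi> n r T \<longleftrightarrow>
    T \<in> ring_hom (restricted_ring \<pi> n r) (restricted_ring \<pi> n r) \<and>
    (\<forall>c\<in>Api \<pi>. T (const_series c) = const_series c)"

definition eval_mon :: "mon \<Rightarrow> (nat list \<Rightarrow> 'a) \<Rightarrow> 'a::comm_ring_1"
  where "eval_mon m x = (\<Prod>\<mu>\<in>Poly_Mapping.keys m. x \<mu> ^ Poly_Mapping.lookup m \<mu>)"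

definition eval_series :: "'a::nonarch_field series \<Rightarrow> (nat list \<Rightarrow> 'a) \<Rightarrow> 'a"
  where "eval_series F x = (\<Sum>\<^sub>\<infinity>m. F m * eval_mon m x)"

text \<open>Substitution of the polynomial \<open>g \<mu>\<close> for the variable indexed by \<open>\<mu>\<close>: the series
  \<open>\<Sum>\<^sub>k F k * (\<Prod>\<^sub>\<mu> g \<mu> ^ k \<mu>)\<close>, taken coefficientwise.\<close>

definition subst_series ::
    "(nat list \<Rightarrow> (mon \<Rightarrow>\<^sub>0 'a)) \<Rightarrow> 'a::nonarch_field series \<Rightarrow> 'a series"
  where "subst_series g F = (\<lambda>m. \<Sum>\<^sub>\<infinity>k. F k * Poly_Mapping.lookup (eval_mon k g) m)"


section \<open>Differential operators and analytic functions\<close>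

text \<open>Functions on \<open>Api \<pi>\<close> are represented by extensional functions. The index set \<open>C\<close> of
  \<open>Phi_oplus\<close> is a set of representatives modulo \<open>\<pi> ^ r\<close>, hence finite, so that arbitrary
  families indexed by it form the direct sum.\<close>

definition Delta ::
    "nat \<Rightarrow> 'a::nonarch_field \<Rightarrow> (nat \<Rightarrow> 'a \<Rightarrow> 'a) \<Rightarrow> 'a series \<Rightarrow> 'a \<Rightarrow> 'a"
  where "Delta p \<pi> \<phi> G = (\<lambda>v\<in>Api \<pi>. eval_series G (\<lambda>\<mu>. delta_word p \<pi> \<phi> \<mu> v))"

definition Phi ::
    "'a::nonarch_field \<Rightarrow> (nat \<Rightarrow> 'a \<Rightarrow> 'a) \<Rightarrow> 'a series \<Rightarrow> 'a \<Rightarrow> 'a"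
  where "Phi \<pi> \<phi> G = (\<lambda>v\<in>Api \<pi>. eval_series G (\<lambda>\<mu>. phi_word \<phi> \<mu> v))"

definition is_pdo ::
    "nat \<Rightarrow> 'a::nonarch_field \<Rightarrow> nat \<Rightarrow> (nat \<Rightarrow> 'a \<Rightarrow> 'a) \<Rightarrow> nat \<Rightarrow> ('a \<Rightarrow> 'a) \<Rightarrow> bool"
  where "is_pdo p \<pi> n \<phi> r f \<longleftrightarrow> (\<exists>G\<in>carrier (restricted_ring \<pi> n r). f = Delta p \<pi> \<phi> G)"

definition is_analytic ::
    "'a::nonarch_field \<Rightarrow> nat \<Rightarrow> (nat \<Rightarrow> 'a \<Rightarrow> 'a) \<Rightarrow> nat \<Rightarrow> ('a \<Rightarrow> 'a) \<Rightarrow> bool"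
  where "is_analytic \<pi> n \<phi> r f \<longleftrightarrow>
    f \<in> Api \<pi> \<rightarrow>\<^sub>E Api \<pi> \<and>
    (\<forall>a\<in>Api \<pi>. \<exists>F\<in>carrier (restricted_ring \<pi> n r). \<forall>u\<in>Api \<pi>. f (a + \<pi> ^ r * u) = Phi \<pi> \<phi> F u)"

definition is_centers :: "'a::nonarch_field \<Rightarrow> nat \<Rightarrow> 'a set \<Rightarrow> bool"
  where "is_centers \<pi> r C \<longleftrightarrow>
    C \<subseteq> Api \<pi> \<and>
    (\<forall>v\<in>Api \<pi>. \<exists>!(a, u). a \<in> C \<and> u \<in> Api \<pi> \<and> v = a + \<pi> ^ r * u)"

definition Phi_oplus ::
    "'a::nonarch_field \<Rightarrow> (nat \<Rightarrow> 'a \<Rightarrow> 'a) \<Rightarrow> nat \<Rightarrow> 'a set \<Rightarrow> ('a \<Rightarrow> 'a series) \<Rightarrow> 'a \<Rightarrow> 'a"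
  where "Phi_oplus \<pi> \<phi> r C F = (\<lambda>v\<in>Api \<pi>.
    case (THE (a, u). a \<in> C \<and> u \<in> Api \<pi> \<and> v = a + \<pi> ^ r * u) of (a, u) \<Rightarrow> Phi \<pi> \<phi> (F a) u)"

definition J :: "nat \<Rightarrow> nat \<Rightarrow> nat \<Rightarrow> nat list \<Rightarrow> mon set"
  where "J p n r \<mu> =
    {j. Poly_Mapping.keys j \<subseteq> subwords n r \<mu> \<and> Poly_Mapping.lookup j \<mu> = 0 \<and>
        (\<Sum>\<nu>\<in>subwords n r \<mu>. Poly_Mapping.lookup j \<nu>) \<le> p ^ length \<mu>} \<union>
    {Poly_Mapping.single \<mu> 1}"

definition expansion_coeffs ::
    "nat \<Rightarrow> 'a::nonarch_field \<Rightarrow> nat \<Rightarrow> (nat \<Rightarrow> 'a \<Rightarrow> 'a) \<Rightarrow> nat \<Rightarrow>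
     ('a \<Rightarrow> mon \<Rightarrow> nat list \<Rightarrow> 'a) \<Rightarrow> bool"
  where "expansion_coeffs p \<pi> n \<phi> r c \<longleftrightarrow>
    (\<forall>a\<in>Api \<pi>. \<forall>\<mu>\<in>words n r.
      (\<forall>j\<in>J p n r \<mu>. c a j \<mu> \<in> Api \<pi>) \<and>
      (\<forall>u\<in>Api \<pi>. delta_word p \<pi> \<phi> \<mu> (a + \<pi> ^ r * u) =
        (\<Sum>j\<in>J p n r \<mu>. c a j \<mu> *
          (\<Prod>\<nu>\<in>subwords n r \<mu>. phi_word \<phi> \<nu> u ^ Poly_Mapping.lookup j \<nu>))))"

text \<open>\<open>tau_gen p n r c a \<mu>\<close> is the polynomial to which \<open>tau\<close> sends the variable indexed by
  \<open>\<mu>\<close>; \<open>Poly_Mapping.single j c\<close> is the monomial with exponent \<open>j\<close> and coefficient \<open>c\<close>.\<close>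

definition tau_gen ::
    "nat \<Rightarrow> nat \<Rightarrow> nat \<Rightarrow> ('a \<Rightarrow> mon \<Rightarrow> nat list \<Rightarrow> 'a::nonarch_field) \<Rightarrow> 'a \<Rightarrow> nat list \<Rightarrow>
     (mon \<Rightarrow>\<^sub>0 'a)"
  where "tau_gen p n r c a \<mu> = (\<Sum>j\<in>J p n r \<mu>. Poly_Mapping.single j (c a j \<mu>))"

definition tau ::
    "nat \<Rightarrow> nat \<Rightarrow> nat \<Rightarrow> ('a \<Rightarrow> mon \<Rightarrow> nat list \<Rightarrow> 'a::nonarch_field) \<Rightarrow> 'a \<Rightarrow>
     'a series \<Rightarrow> 'a series"
  where "tau p n r c a = subst_series (tau_gen p n r c a)"

end

theory Submission
  imports Defs
begin

text \<open>An operator \<open>\<Delta>(F)\<close> plugs the values \<open>\<delta>\<^sub>\<mu>(v)\<close> into the restricted power series \<open>F\<close>. On a ball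
  \<open>v = a + \<pi>\<^sup>r u\<close> each \<open>\<delta>\<^sub>\<mu>(v)\<close> is a polynomial in the \<open>\<phi>\<^sub>\<nu>(u)\<close> with coefficients in \<open>Api \<pi>\<close>.
  Substituting these polynomials for the variables of \<open>F\<close> gives a restricted series whose values at the
  \<open>\<phi>\<^sub>\<nu>(u)\<close> are those of \<open>\<Delta>(F)\<close> on the ball. Two things need an argument.

  First, substitution must make sense and be compatible with ring operations and with evaluation
  (\<open>restricted_alg_hom_subst_series\<close>, \<open>eval_series_subst_series\<close>). In all the double series involved, one
  index runs over the monomials of a series whose coefficients tend to zero and the other over those of a
  polynomial with integral coefficients, or of a second series tending to zero. Hence only finitely many
  terms lie outside each power of \<open>(\<pi>)\<close>, the double series converge unconditionally, and they may be
  rearranged. Limits stay in \<open>Api \<pi>\<close> because it is compact (\<open>compact_Api\<close>): by division by the Eisenstein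
  polynomial it is generated as a module over the compact ring \<open>Zp\<close> by finitely many powers of \<open>\<pi>\<close>.

  Second, for analyticity, such polynomials must exist (\<open>delta_word_expansion\<close>). For \<open>\<mu>\<close> of length \<open>s\<close>,
  \<open>\<delta>\<^sub>\<mu>(a + \<pi>\<^sup>r u) = \<delta>\<^sub>\<mu>(a) + \<pi> ^ (r - s) Q(u)\<close> with \<open>Q\<close> a polynomial in the \<open>\<phi>\<^sub>\<nu>(u)\<close> of words of length at most
  \<open>s\<close>. One more letter divides by \<open>\<pi>\<close> and costs one of the \<open>r\<close> available factors. The constant part remains
  integral because in \<open>Api \<pi>\<close> an absolute value below 1 means divisibility by \<open>\<pi>\<close> (\<open>Api_nonunit\<close>), so that
  the Frobenius congruence makes every \<open>\<delta>\<^sub>i\<close> map \<open>Api \<pi>\<close> to itself.\<close>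

section \<open>Non-archimedean absolute values\<close>

lemma absv_0 [simp]: "absv (0::'a::nonarch_field) = 0"
  using dist_absv[of "0::'a" 0] by simp

lemma absv_nonneg [simp]: "absv (x::'a::nonarch_field) \<ge> 0"
  using dist_absv[of x 0] zero_le_dist[of x 0] by simp

lemma absv_eq_0_iff [simp]: "absv (x::'a::nonarch_field) = 0 \<longleftrightarrow> x = 0"
  using dist_absv[of x 0] by auto

lemma absv_1 [simp]: "absv (1::'a::nonarch_field) = 1"
  using absv_mult[of "1::'a" 1] by auto

lemma absv_minus [simp]: "absv (- (x::'a::nonarch_field)) = absv x"
  using dist_absv[of x 0] dist_absv[of 0 x] by (simp add: dist_commute)

lemma absv_diff: "absv (x - y :: 'a::nonarch_field) \<le> max (absv x) (absv y)"
  using absv_add[of x "- y"] by simp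

lemma absv_power: "absv ((x::'a::nonarch_field) ^ k) = absv x ^ k"
  by (induction k) (simp_all add: absv_mult)

lemma absv_inverse: "absv (inverse (x::'a::nonarch_field)) = inverse (absv x)"
proof (cases "x = 0")
  case False
  then have "absv x * absv (inverse x) = 1"
    by (simp flip: absv_mult)
  then show ?thesis
    by (simp add: inverse_unique)
qed simp

lemma absv_of_nat_le_1: "absv (of_nat k :: 'a::nonarch_field) \<le> 1"
proof (induction k)
  case (Suc k)
  then show ?case
    using absv_add[of 1 "of_nat k :: 'a"] by simp
qed simp

lemma absv_of_int_le_1: "absv (of_int k :: 'a::nonarch_field) \<le> 1"
  by (cases k) (simp_all add: absv_of_nat_le_1 del: of_nat_Suc)

lemma absv_eq_of_close:
  fixes x y :: "'a::nonarch_field"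
  assumes "absv (x - y) < absv x"
  shows "absv y = absv x"
  using absv_add[of "x - y" y] absv_diff[of x "x - y"] assms by (simp add: max_def split: if_splits)

lemma absv_sum_le:
  fixes f :: "'i \<Rightarrow> 'a::nonarch_field"
  assumes "\<And>i. i \<in> I \<Longrightarrow> absv (f i) \<le> B" "B \<ge> 0"
  shows "absv (sum f I) \<le> B"
  using assms(1)
proof (induction I rule: infinite_finite_induct)
  case (insert i I)
  then show ?case
    using absv_add[of "f i" "sum f I"] by (force simp: max_def split: if_splits)
qed (simp_all add: assms(2))

text \<open>With continuous ring operations, unconditional sums can be added, scaled and iterated.\<close>

instance nonarch_field \<subseteq> topological_ab_group_add
proof
  fix a b :: 'a
  have "((\<lambda>x. fst x + snd x) \<longlongrightarrow> a + b) (nhds (a, b))"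
    unfolding tendsto_iff
  proof (intro allI impI)
    fix e :: real
    assume "e > 0"
    have "\<forall>x. dist x (a, b) < e \<longrightarrow> dist (fst x + snd x) (a + b) < e"
    proof (intro allI impI)
      fix x :: "'a \<times> 'a"
      assume "dist x (a, b) < e"
      then have "dist (fst x) a < e" "dist (snd x) b < e"
        using dist_fst_le[of x "(a, b)"] dist_snd_le[of x "(a, b)"] by simp_all
      then show "dist (fst x + snd x) (a + b) < e"
        using absv_add[of "fst x - a" "snd x - b"] by (simp add: dist_absv algebra_simps)
    qed
    then show "\<forall>\<^sub>F x in nhds (a, b). dist (fst x + snd x) (a + b) < e"
      using \<open>e > 0\<close> unfolding eventually_nhds_metric by auto
  qed
  then show "LIM x (nhds a \<times>\<^sub>F nhds b). fst x + snd x :> nhds (a + b)"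
    unfolding nhds_prod .
  show "(uminus \<longlongrightarrow> - a) (nhds a)"
    unfolding tendsto_iff
  proof (intro allI impI)
    fix e :: real
    assume "e > 0"
    then show "\<forall>\<^sub>F x in nhds a. dist (- x) (- a) < e"
      unfolding eventually_nhds_metric
      by (intro exI[of _ e]) (metis absv_minus dist_absv minus_diff_minus)
  qed
qed

instance nonarch_field \<subseteq> topological_semigroup_mult
proof
  fix a b :: 'a
  have "((\<lambda>x. fst x * snd x) \<longlongrightarrow> a * b) (nhds (a, b))"
    unfolding tendsto_iff
  proof (intro allI impI)
    fix e :: real
    assume e: "e > 0"
    define M where "M = max 1 (max (absv a) (absv b))"
    define d where "d = min 1 (e / M)"
    have M: "M \<ge> 1" "absv a \<le> M" "absv b \<le> M"
      by (simp_all add: M_def)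
    have d: "d > 0" "d \<le> 1" "d * M \<le> e"
      using e M by (simp_all add: d_def min_def field_simps)
    have small: "s * t < e" if "0 \<le> s" "s < d" "0 \<le> t" "t \<le> M" for s t
    proof -
      have "s * t \<le> s * M" using that by (intro mult_left_mono)
      also have "\<dots> < d * M" using that M(1) by (intro mult_strict_right_mono) auto
      finally show ?thesis using d(3) by simp
    qed
    have "\<forall>x. dist x (a, b) < d \<longrightarrow> dist (fst x * snd x) (a * b) < e"
    proof (intro allI impI)
      fix x :: "'a \<times> 'a"
      assume "dist x (a, b) < d"
      then have x: "absv (fst x - a) < d" "absv (snd x - b) < d"
        using dist_fst_le[of x "(a, b)"] dist_snd_le[of x "(a, b)"] by (simp_all add: dist_absv)
      have "absv (snd x) \<le> M"
        using absv_add[of "snd x - b" b] x d M by simp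
      then have "absv ((fst x - a) * snd x) < e"
        using small[OF _ x(1)] by (simp add: absv_mult)
      moreover have "absv (a * (snd x - b)) < e"
        using small[OF _ x(2) _ M(2)] by (simp add: absv_mult mult.commute)
      ultimately show "dist (fst x * snd x) (a * b) < e"
        using absv_add[of "(fst x - a) * snd x" "a * (snd x - b)"]
        by (simp add: dist_absv algebra_simps)
    qed
    then show "\<forall>\<^sub>F x in nhds (a, b). dist (fst x * snd x) (a * b) < e"
      using \<open>d > 0\<close> unfolding eventually_nhds_metric by auto
  qed
  then show "LIM x (nhds a \<times>\<^sub>F nhds b). fst x * snd x :> nhds (a * b)"
    unfolding nhds_prod .
qed

section \<open>The p-adic numbers as the closure of the rationals\<close>

lemma Rats_subset_Qp: "\<rat> \<subseteq> (Qp :: 'a::nonarch_field set)"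
  by (simp add: Qp_def closure_subset)

lemma Qp_approx:
  assumes "(x::'a::nonarch_field) \<in> Qp" "e > 0"
  obtains q where "q \<in> \<rat>" "absv (x - q) < e"
  using assms unfolding Qp_def closure_approachable by (metis dist_absv dist_commute)

lemma Qp_add:
  assumes "x \<in> Qp" "y \<in> Qp"
  shows "x + y \<in> (Qp :: 'a::nonarch_field set)"
proof -
  from assms obtain f g where "\<forall>n. f n \<in> \<rat>" "f \<longlonglongrightarrow> x" "\<forall>n. g n \<in> \<rat>" "g \<longlonglongrightarrow> y"
    unfolding Qp_def closure_sequential by auto
  then have "(\<forall>n. f n + g n \<in> \<rat>) \<and> (\<lambda>n. f n + g n) \<longlonglongrightarrow> x + y"
    by (auto intro: tendsto_add)
  then show ?thesis
    unfolding Qp_def closure_sequential by (intro exI[of _ "\<lambda>n. f n + g n"])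
qed

lemma Qp_mult:
  assumes "x \<in> Qp" "y \<in> Qp"
  shows "x * y \<in> (Qp :: 'a::nonarch_field set)"
proof -
  from assms obtain f g where "\<forall>n. f n \<in> \<rat>" "f \<longlonglongrightarrow> x" "\<forall>n. g n \<in> \<rat>" "g \<longlonglongrightarrow> y"
    unfolding Qp_def closure_sequential by auto
  then have "(\<forall>n. f n * g n \<in> \<rat>) \<and> (\<lambda>n. f n * g n) \<longlonglongrightarrow> x * y"
    by (auto intro: tendsto_mult)
  then show ?thesis
    unfolding Qp_def closure_sequential by (intro exI[of _ "\<lambda>n. f n * g n"])
qed

lemma Qp_minus: "x \<in> Qp \<Longrightarrow> - x \<in> (Qp :: 'a::nonarch_field set)"
  using Qp_mult[of "- 1" x] subsetD[OF Rats_subset_Qp, of "- 1"] by simp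

lemma Zp_add: "x \<in> Zp \<Longrightarrow> y \<in> Zp \<Longrightarrow> x + y \<in> (Zp :: 'a::nonarch_field set)"
  using absv_add[of x y] by (auto simp: Zp_def Qp_add)

lemma Zp_mult: "x \<in> Zp \<Longrightarrow> y \<in> Zp \<Longrightarrow> x * y \<in> (Zp :: 'a::nonarch_field set)"
  by (auto simp: Zp_def Qp_mult absv_mult mult_le_one)

lemma Zp_minus: "x \<in> Zp \<Longrightarrow> - x \<in> (Zp :: 'a::nonarch_field set)"
  by (auto simp: Zp_def Qp_minus)

lemma of_int_in_Zp: "of_int k \<in> (Zp :: 'a::nonarch_field set)"
  using Rats_subset_Qp by (auto simp: Zp_def absv_of_int_le_1)

lemma zero_in_Zp: "0 \<in> (Zp :: 'a::nonarch_field set)"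
  and one_in_Zp: "1 \<in> (Zp :: 'a::nonarch_field set)"
  using of_int_in_Zp[of 0] of_int_in_Zp[of 1] by simp_all

lemma Zp_sum: "(\<And>i. i \<in> I \<Longrightarrow> f i \<in> Zp) \<Longrightarrow> sum f I \<in> (Zp :: 'a::nonarch_field set)"
  by (induction I rule: infinite_finite_induct) (auto simp: zero_in_Zp Zp_add)

text \<open>Rationals close to a unit \<open>x\<close> are units too, and their inverses are just as close to the inverse
  of \<open>x\<close>.\<close>

lemma Zp_inverse:
  assumes x: "(x::'a::nonarch_field) \<in> Zp" "absv x = 1"
  shows "inverse x \<in> Zp"
proof -
  have "inverse x \<in> closure \<rat>"
    unfolding closure_approachable
  proof (intro allI impI)
    fix e :: real
    assume "e > 0"
    moreover have "x \<in> Qp" using x by (simp add: Zp_def)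
    ultimately obtain q where q: "q \<in> \<rat>" "absv (x - q) < min e 1"
      using Qp_approx[of x "min e 1"] by auto
    then have q1: "absv q = 1"
      using absv_eq_of_close[of x q] x(2) by simp
    then have "q \<noteq> 0" "x \<noteq> 0" using x(2) by auto
    then have "inverse q - inverse x = (x - q) * inverse q * inverse x"
      by (simp add: field_simps)
    then have "dist (inverse q) (inverse x) < e"
      using q q1 x(2) by (simp add: dist_absv absv_mult absv_inverse)
    then show "\<exists>y\<in>\<rat>. dist y (inverse x) < e"
      using q(1) Rats_inverse by blast
  qed
  then show ?thesis
    using x(2) by (simp add: Zp_def Qp_def absv_inverse)
qed

text \<open>The parameter \<open>T\<close> names the field, which facts about \<open>p\<close> alone, such as \<open>p_gt_1\<close>, do not mention.\<close>

locale padic_valued =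
  fixes p :: nat and T :: "'a::nonarch_field itself"
  assumes prime_p: "Factorial_Ring.prime p"
    and absv_p: "absv (of_nat p :: 'a) = 1 / real p"
    and complete_Qp: "complete (Qp :: 'a set)"
begin

lemma p_gt_1: "p > 1"
  using prime_p prime_gt_1_nat by blast

lemma p_nz: "(of_nat p :: 'a) \<noteq> 0"
  using p_gt_1 by simp

lemma absv_int_le: "int p dvd k \<Longrightarrow> absv (of_int k :: 'a) \<le> 1 / real p"
  using absv_of_int_le_1[where 'a='a]
  by (auto simp: dvd_def absv_mult absv_p divide_simps)

text \<open>In a Bezout relation between \<open>k\<close> and \<open>p\<close> the multiple of \<open>p\<close> is small, so the multiple of \<open>k\<close> has
  absolute value 1.\<close>

lemma absv_int_eq_1:
  assumes "\<not> int p dvd k"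
  shows "absv (of_int k :: 'a) = 1"
proof -
  have "coprime (int p) k"
    using assms prime_p by (simp add: prime_imp_coprime)
  then obtain u v where uv: "u * int p + v * k = 1"
    using coprime_iff_gcd_eq_1 bezout_int by metis
  have "1 \<le> max (absv (of_int (u * int p) :: 'a)) (absv (of_int (v * k) :: 'a))"
    using absv_add[of "of_int (u * int p) :: 'a" "of_int (v * k)"] uv
    by (metis absv_1 of_int_1 of_int_add)
  moreover have "absv (of_int (u * int p) :: 'a) < 1"
    using absv_int_le[of "u * int p"] p_gt_1 by (simp add: le_less_trans)
  ultimately have "1 \<le> absv (of_int v :: 'a) * absv (of_int k :: 'a)"
    by (simp add: absv_mult max_def split: if_splits)
  also have "\<dots> \<le> 1 * absv (of_int k :: 'a)"
    by (intro mult_right_mono) (auto simp: absv_of_int_le_1)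
  finally show ?thesis
    using absv_of_int_le_1[of k, where 'a='a] by simp
qed

text \<open>Writing a rational of absolute value at most 1 with a denominator prime to \<open>p\<close>, an inverse of
  the denominator modulo \<open>p\<close> gives an integer in the same residue class.\<close>

lemma rat_residue:
  assumes q: "(q::'a) \<in> \<rat>" "absv q \<le> 1"
  obtains k :: int where "absv (q - of_int k) \<le> 1 / real p"
proof -
  obtain r where r: "q = of_rat r" using q(1) by (elim Rats_cases)
  obtain a b where ab: "quotient_of r = (a, b)" by (cases "quotient_of r")
  then have b0: "b > 0" and cop: "coprime a b" and "r = of_int a / of_int b"
    by (auto simp: quotient_of_denom_pos quotient_of_coprime quotient_of_div)
  then have qab: "q = of_int a / of_int b" by (simp add: r of_rat_divide)
  then have qb: "q * of_int b = of_int a" using b0 by simp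
  \<comment> \<open>A fraction in lowest terms with denominator divisible by \<open>p\<close> has absolute value above 1.\<close>
  have nb: "\<not> int p dvd b"
  proof
    assume d: "int p dvd b"
    then have "\<not> int p dvd a"
      using cop p_gt_1 by (metis coprime_common_divisor_int int_ops(2) abs_of_nat less_irrefl of_nat_eq_iff)
    then have "absv (of_int a :: 'a) = 1" by (rule absv_int_eq_1)
    then have "1 = absv q * absv (of_int b :: 'a)"
      using qb by (metis absv_mult)
    also have "\<dots> \<le> 1 * (1 / real p)"
      using q(2) absv_int_le[OF d] by (intro mult_mono) auto
    finally show False using p_gt_1 by simp
  qed
  then have "coprime (int p) b"
    using prime_p by (simp add: prime_imp_coprime)
  then obtain u v where uv: "u * int p + v * b = 1"
    using coprime_iff_gcd_eq_1 bezout_int by metis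
  have "of_int b * (q - of_int (a * v)) = (of_int (a * u * int p) :: 'a)"
  proof -
    have "of_int b * (q - of_int (a * v)) = (of_int (a * (1 - v * b)) :: 'a)"
      using qb by (simp add: algebra_simps)
    also have "1 - v * b = u * int p" using uv by simp
    finally show ?thesis by (simp add: mult.assoc)
  qed
  then have "absv (q - of_int (a * v)) = absv (of_int (a * u * int p) :: 'a)"
    by (metis absv_int_eq_1[OF nb] absv_mult mult_1)
  then have "absv (q - of_int (a * v)) \<le> 1 / real p"
    using absv_int_le[of "a * u * int p"] by simp
  then show ?thesis by (rule that)
qed

lemma Zp_divide_p:
  assumes "(z::'a) \<in> Qp" "absv z \<le> 1 / real p"
  shows "\<exists>w\<in>Zp. z = of_nat p * w"
proof -
  have "inverse (of_nat p) \<in> (Qp :: 'a set)"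
    using Rats_subset_Qp by (auto intro: Rats_inverse)
  then have "z / of_nat p \<in> Qp"
    unfolding divide_inverse by (rule Qp_mult[OF assms(1)])
  moreover have "absv (z / of_nat p) \<le> 1"
  proof -
    have "absv (z / of_nat p) = absv z * real p"
      by (simp add: divide_inverse absv_mult absv_inverse absv_p)
    also have "\<dots> \<le> 1 / real p * real p"
      by (intro mult_right_mono assms(2)) simp
    finally show ?thesis using p_gt_1 by simp
  qed
  ultimately have "z / of_nat p \<in> Zp" by (simp add: Zp_def)
  then show ?thesis using p_nz by (intro bexI[of _ "z / of_nat p"]) auto
qed

text \<open>Density of the rationals reduces this to \<open>rat_residue\<close>; the integer found there is then reduced
  modulo \<open>p\<close>.\<close>

lemma Zp_digit:
  assumes z: "(z::'a) \<in> Zp"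
  obtains k w where "w \<in> Zp" "k < p" "z = of_nat k + of_nat p * w"
proof -
  have "z \<in> Qp" "absv z \<le> 1" using z by (auto simp: Zp_def)
  moreover have "1 / real p > 0" using p_gt_1 by simp
  ultimately obtain q where q: "q \<in> \<rat>" "absv (z - q) < 1 / real p"
    using Qp_approx by metis
  have qlt: "absv (z - q) < 1"
    using q(2) p_gt_1 by (auto elim: order.strict_trans)
  have "absv q \<le> 1"
    using absv_diff[of z "z - q"] \<open>absv z \<le> 1\<close> qlt by simp
  then obtain c where c: "absv (q - of_int c) \<le> 1 / real p"
    using rat_residue q(1) by blast
  define k where "k = nat (c mod int p)"
  have k: "int k = c mod int p" "k < p"
    using p_gt_1 by (simp_all add: k_def nat_less_iff)
  have "int p dvd (c - int k)" by (simp add: k)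
  then have "absv (of_int (c - int k) :: 'a) \<le> 1 / real p" by (rule absv_int_le)
  then have "absv ((q - of_int c) + of_int (c - int k)) \<le> 1 / real p"
    using c absv_add[of "q - of_int c" "of_int (c - int k)"] by linarith
  then have "absv ((z - q) + ((q - of_int c) + of_int (c - int k))) \<le> 1 / real p"
    using q(2) absv_add[of "z - q" "(q - of_int c) + of_int (c - int k)"] by linarith
  then have "absv (z - of_nat k) \<le> 1 / real p" by simp
  moreover have "z - of_nat k \<in> Qp"
    using \<open>z \<in> Qp\<close> of_int_in_Zp[of "int k", where 'a='a] Qp_add[of z "- of_nat k"]
      Qp_minus[of "of_nat k :: 'a"]
    by (simp add: Zp_def)
  ultimately obtain w where "w \<in> Zp" "z - of_nat k = of_nat p * w"
    using Zp_divide_p by blast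
  then show ?thesis using that[of w k] k(2) by (simp add: algebra_simps)
qed

lemma Zp_nonunit:
  assumes z: "(z::'a) \<in> Zp" "absv z \<noteq> 1"
  shows "\<exists>w\<in>Zp. z = of_nat p * w"
proof -
  obtain k w where kw: "w \<in> Zp" "k < p" "z = of_nat k + of_nat p * w"
    using Zp_digit z(1) by blast
  have "absv (of_nat p * w) < 1"
    using kw(1) p_gt_1 by (auto simp: absv_mult absv_p Zp_def divide_simps intro: le_less_trans)
  moreover have "absv z < 1" using z by (simp add: Zp_def)
  ultimately have "absv (of_nat k :: 'a) < 1"
    using absv_diff[of z "of_nat p * w"] kw(3) by simp
  then have "int p dvd int k" using absv_int_eq_1[of "int k"] by auto
  then have "k = 0" using kw(2) by (metis int_dvd_int_iff nat_dvd_not_less neq0_conv)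
  then show ?thesis using kw by auto
qed

lemma Zp_digits:
  "\<forall>z\<in>(Zp :: 'a set). \<exists>k<p ^ N. \<exists>w\<in>Zp. z = of_nat k + of_nat p ^ N * w"
proof (induction N)
  case (Suc N)
  show ?case
  proof
    fix z :: 'a
    assume "z \<in> Zp"
    then obtain k w where kw: "w \<in> Zp" "k < p ^ N" "z = of_nat k + of_nat p ^ N * w"
      using Suc by blast
    obtain l v where lv: "v \<in> Zp" "l < p" "w = of_nat l + of_nat p * v"
      using Zp_digit kw(1) by blast
    have "k + p ^ N * l < p ^ N * Suc l" using kw(2) by simp
    also have "\<dots> \<le> p ^ N * p" using lv(2) by (intro mult_left_mono) auto
    finally have "k + p ^ N * l < p ^ Suc N" by (simp add: mult.commute)
    moreover have "z = of_nat (k + p ^ N * l) + of_nat p ^ Suc N * v"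
      using kw(3) lv(3) by (simp add: algebra_simps)
    ultimately show "\<exists>k<p ^ Suc N. \<exists>w\<in>Zp. z = of_nat k + of_nat p ^ Suc N * w"
      using lv(1) by blast
  qed
qed auto

text \<open>The digit expansion makes \<open>Zp\<close> totally bounded, and it is closed in the complete \<open>Qp\<close>.\<close>

lemma compact_Zp: "compact (Zp :: 'a set)"
  unfolding compact_eq_totally_bounded
proof (intro conjI allI impI)
  have "Zp = Qp \<inter> (cball 0 1 :: 'a set)"
    by (auto simp: Zp_def dist_absv)
  then show "complete (Zp :: 'a set)"
    using complete_Qp closed_cball by (metis closed_Int complete_imp_closed complete_closed_subset inf_le1)
  fix e :: real
  assume "e > 0"
  then obtain N where N: "(1 / real p) ^ N < e"
    using real_arch_pow_inv[of e "1 / real p"] p_gt_1 by auto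
  have "Zp \<subseteq> (\<Union>x\<in>of_nat ` {..<p ^ N}. ball x e :: 'a set)"
  proof
    fix z :: 'a
    assume "z \<in> Zp"
    then obtain k w where kw: "w \<in> Zp" "k < p ^ N" "z = of_nat k + of_nat p ^ N * w"
      using Zp_digits by blast
    have "dist (of_nat k) z = absv (of_nat p ^ N * w)"
      using kw(3) by (metis add_diff_cancel_left' dist_absv dist_commute)
    also have "\<dots> \<le> (1 / real p) ^ N * 1"
      using kw(1) unfolding absv_mult absv_power absv_p Zp_def by (intro mult_left_mono) auto
    finally show "z \<in> (\<Union>x\<in>of_nat ` {..<p ^ N}. ball x e)"
      using N kw(2) by (auto intro!: bexI[of _ k])
  qed
  then show "\<exists>k. finite k \<and> Zp \<subseteq> (\<Union>x\<in>k. ball x e :: 'a set)"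
    by (intro exI[of _ "of_nat ` {..<p ^ N}"]) auto
qed

end

section \<open>The order generated by a root of an Eisenstein polynomial\<close>

lemma Zp_subset_Api: "Zp \<subseteq> Api (\<pi>::'a::nonarch_field)"
proof
  fix z :: 'a
  assume "z \<in> Zp"
  then have "z = poly [:z:] \<pi> \<and> (\<forall>i. Polynomial.coeff [:z:] i \<in> Zp)"
    by (simp add: coeff_pCons' zero_in_Zp)
  then show "z \<in> Api \<pi>" unfolding Api_def by blast
qed

lemma Api_step: "z \<in> Zp \<Longrightarrow> b \<in> Api \<pi> \<Longrightarrow> z + \<pi> * b \<in> Api (\<pi>::'a::nonarch_field)"
proof -
  assume z: "z \<in> Zp" and "b \<in> Api \<pi>"
  then obtain q where q: "b = poly q \<pi>" "\<forall>i. Polynomial.coeff q i \<in> Zp"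
    unfolding Api_def by blast
  then have "z + \<pi> * b = poly (pCons z q) \<pi> \<and> (\<forall>i. Polynomial.coeff (pCons z q) i \<in> Zp)"
    using z by (simp add: coeff_pCons')
  then show ?thesis unfolding Api_def by blast
qed

text \<open>Horner's scheme: an element of the order is 0 or arises from one of lower degree by multiplying by
  \<open>\<pi>\<close> and adding a p-adic integer.\<close>

lemma Api_induct [consumes 1, case_names 0 step]:
  assumes "a \<in> Api (\<pi>::'a::nonarch_field)" "P 0"
    and step: "\<And>z b. z \<in> Zp \<Longrightarrow> b \<in> Api \<pi> \<Longrightarrow> P b \<Longrightarrow> P (z + \<pi> * b)"
  shows "P a"
proof -
  have "P (poly q \<pi>)" if "\<forall>i. Polynomial.coeff q i \<in> Zp" for q
    using that
  proof (induction q)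
    case (pCons z q)
    then have "z \<in> Zp" "\<forall>i. Polynomial.coeff q i \<in> Zp"
      by (metis coeff_pCons_0, metis coeff_pCons_Suc)
    then show ?case
      using pCons.IH step[of z "poly q \<pi>"] by (auto simp: Api_def)
  qed (simp add: assms(2))
  then show ?thesis using assms(1) by (auto simp: Api_def)
qed

lemma zero_in_Api: "0 \<in> Api (\<pi>::'a::nonarch_field)"
  and one_in_Api: "1 \<in> Api (\<pi>::'a::nonarch_field)"
  using Zp_subset_Api zero_in_Zp one_in_Zp by blast+

lemma pi_in_Api: "\<pi> \<in> Api (\<pi>::'a::nonarch_field)"
  using Api_step[OF zero_in_Zp one_in_Api] by simp

lemma Api_add: "a \<in> Api \<pi> \<Longrightarrow> b \<in> Api \<pi> \<Longrightarrow> a + b \<in> Api (\<pi>::'a::nonarch_field)"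
proof -
  assume "a \<in> Api \<pi>" "b \<in> Api \<pi>"
  then obtain f g where "a = poly f \<pi>" "\<forall>i. Polynomial.coeff f i \<in> Zp"
    "b = poly g \<pi>" "\<forall>i. Polynomial.coeff g i \<in> Zp"
    unfolding Api_def by blast
  then have "a + b = poly (f + g) \<pi> \<and> (\<forall>i. Polynomial.coeff (f + g) i \<in> Zp)"
    by (simp add: Zp_add)
  then show ?thesis unfolding Api_def by blast
qed

lemma Api_mult: "a \<in> Api \<pi> \<Longrightarrow> b \<in> Api \<pi> \<Longrightarrow> a * b \<in> Api (\<pi>::'a::nonarch_field)"
proof -
  assume "a \<in> Api \<pi>" "b \<in> Api \<pi>"
  then obtain f g where "a = poly f \<pi>" "\<forall>i. Polynomial.coeff f i \<in> Zp"
    "b = poly g \<pi>" "\<forall>i. Polynomial.coeff g i \<in> Zp"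
    unfolding Api_def by blast
  then have "a * b = poly (f * g) \<pi> \<and> (\<forall>i. Polynomial.coeff (f * g) i \<in> Zp)"
    by (auto simp: coeff_mult intro!: Zp_sum Zp_mult)
  then show ?thesis unfolding Api_def by blast
qed

lemma Api_minus: "a \<in> Api \<pi> \<Longrightarrow> - a \<in> Api (\<pi>::'a::nonarch_field)"
proof -
  assume "a \<in> Api \<pi>"
  then have "- 1 * a \<in> Api \<pi>"
    using Zp_subset_Api Zp_minus[OF one_in_Zp] by (intro Api_mult) auto
  then show ?thesis by simp
qed

lemma Api_diff: "a \<in> Api \<pi> \<Longrightarrow> b \<in> Api \<pi> \<Longrightarrow> a - b \<in> Api (\<pi>::'a::nonarch_field)"
  using Api_add[of a \<pi> "- b"] Api_minus[of b \<pi>] by simp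

lemma Api_power: "a \<in> Api \<pi> \<Longrightarrow> a ^ k \<in> Api (\<pi>::'a::nonarch_field)"
  by (induction k) (auto intro: one_in_Api Api_mult)

lemma Api_sum: "(\<And>i. i \<in> I \<Longrightarrow> f i \<in> Api \<pi>) \<Longrightarrow> sum f I \<in> Api (\<pi>::'a::nonarch_field)"
  by (induction I rule: infinite_finite_induct) (auto intro: zero_in_Api Api_add)

lemma Api_prod: "(\<And>i. i \<in> I \<Longrightarrow> f i \<in> Api \<pi>) \<Longrightarrow> prod f I \<in> Api (\<pi>::'a::nonarch_field)"
  by (induction I rule: infinite_finite_induct) (auto intro: one_in_Api Api_mult)

lemma absv_Api_le_1:
  assumes "absv (\<pi>::'a::nonarch_field) \<le> 1" "a \<in> Api \<pi>"
  shows "absv a \<le> 1"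
  using assms(2)
proof (induction rule: Api_induct)
  case (step z b)
  have "absv (\<pi> * b) \<le> 1" using assms(1) step(3) by (simp add: absv_mult mult_le_one)
  moreover have "absv z \<le> 1" using step(1) by (simp add: Zp_def)
  ultimately show ?case using absv_add[of z "\<pi> * b"] by simp
qed simp

locale eisenstein_root = padic_valued p T
  for p :: nat and T :: "'a::nonarch_field itself" +
  fixes \<pi> :: 'a and E :: "'a poly"
  assumes eisenstein: "eisenstein p E" and root: "poly E \<pi> = 0"
begin

lemma lead_coeff_unit: "Polynomial.lead_coeff E \<in> Zp" "absv (Polynomial.lead_coeff E) = 1"
  using eisenstein Zp_nonunit[of "Polynomial.lead_coeff E"] by (auto simp: eisenstein_def)

text \<open>If the absolute value of \<open>\<pi>\<close> were at least 1, the leading term of \<open>E\<close> at \<open>\<pi>\<close> would dominate all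
  the others, whose coefficients are divisible by \<open>p\<close>, and \<open>E\<close> would not vanish there.\<close>

lemma absv_pi_less_1: "absv \<pi> < 1"
proof (rule ccontr)
  assume "\<not> absv \<pi> < 1"
  then have ge: "absv \<pi> \<ge> 1" by simp
  define e where "e = Polynomial.degree E"
  have e: "e > 0" using eisenstein by (simp add: e_def eisenstein_def)
  have "absv (\<Sum>i<e. Polynomial.coeff E i * \<pi> ^ i) \<le> 1 / real p * absv \<pi> ^ e"
  proof (rule absv_sum_le)
    fix i
    assume i: "i \<in> {..<e}"
    then obtain w where w: "w \<in> Zp" "Polynomial.coeff E i = of_nat p * w"
      using eisenstein by (auto simp: eisenstein_def e_def)
    have "absv (Polynomial.coeff E i) \<le> 1 / real p * 1"
      using w(1) unfolding w(2) absv_mult absv_p Zp_def by (intro mult_left_mono) auto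
    moreover have "absv \<pi> ^ i \<le> absv \<pi> ^ e"
      using ge i by (intro power_increasing) auto
    ultimately show "absv (Polynomial.coeff E i * \<pi> ^ i) \<le> 1 / real p * absv \<pi> ^ e"
      unfolding absv_mult absv_power by (intro mult_mono) auto
  qed simp
  moreover have "poly E \<pi> = (\<Sum>i<e. Polynomial.coeff E i * \<pi> ^ i) + Polynomial.lead_coeff E * \<pi> ^ e"
    unfolding poly_altdef e_def by (simp flip: lessThan_Suc_atMost)
  then have "(\<Sum>i<e. Polynomial.coeff E i * \<pi> ^ i) = - (Polynomial.lead_coeff E * \<pi> ^ e)"
    using root by (simp add: eq_neg_iff_add_eq_0)
  then have "absv (\<Sum>i<e. Polynomial.coeff E i * \<pi> ^ i) = absv \<pi> ^ e"
    using lead_coeff_unit(2) by (simp add: absv_mult absv_power)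
  ultimately have "absv \<pi> ^ e \<le> 1 / real p * absv \<pi> ^ e" by simp
  moreover have "absv \<pi> ^ e > 0" using ge by simp
  ultimately have "1 \<le> 1 / real p" by (simp only: mult_le_cancel_right1)
  then show False using p_gt_1 by simp
qed

lemma absv_Api: "a \<in> Api \<pi> \<Longrightarrow> absv a \<le> 1"
  using absv_pi_less_1 by (simp add: absv_Api_le_1[of \<pi> a])

text \<open>The constant coefficient of \<open>E\<close> is \<open>p\<close> times a unit, and it is a multiple of \<open>\<pi>\<close> because
  \<open>\<pi>\<close> is a root.\<close>

lemma p_multiple_of_pi: "\<exists>w\<in>Api \<pi>. of_nat p = \<pi> * w"
proof -
  obtain a E' where E': "E = pCons a E'" by (cases E)
  have E'c: "\<forall>i. Polynomial.coeff E' i \<in> Zp"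
    using eisenstein unfolding eisenstein_def E' by (metis coeff_pCons_Suc)
  have a: "a = Polynomial.coeff E 0" by (simp add: E')
  then have "a \<in> (\<lambda>x. of_nat p * x) ` Zp" and nsq: "a \<notin> (\<lambda>x. of_nat p ^ 2 * x) ` Zp"
    using eisenstein by (auto simp: eisenstein_def)
  then obtain z where z: "z \<in> Zp" "a = of_nat p * z" by blast
  have z1: "absv z = 1"
  proof (rule ccontr)
    assume "absv z \<noteq> 1"
    then obtain w where "w \<in> Zp" "z = of_nat p * w" using Zp_nonunit z(1) by blast
    then have "a = of_nat p ^ 2 * w" using z(2) by (simp add: power2_eq_square)
    then show False using nsq \<open>w \<in> Zp\<close> by blast
  qed
  then have "z \<noteq> 0" by auto
  have "of_nat p * z + \<pi> * poly E' \<pi> = 0" using root z(2) by (simp add: E')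
  then have "of_nat p * z * inverse z = - (\<pi> * poly E' \<pi>) * inverse z"
    by (metis eq_neg_iff_add_eq_0)
  then have "of_nat p = \<pi> * (- (poly E' \<pi> * inverse z))"
    using \<open>z \<noteq> 0\<close> by (simp add: mult.assoc)
  moreover have "poly E' \<pi> \<in> Api \<pi>" using E'c by (auto simp: Api_def)
  then have "- (poly E' \<pi> * inverse z) \<in> Api \<pi>"
    using Zp_inverse[OF z(1) z1] Zp_subset_Api by (blast intro: Api_minus Api_mult)
  ultimately show ?thesis by blast
qed

lemma pi_nz: "\<pi> \<noteq> 0"
  using p_multiple_of_pi p_nz by auto

text \<open>Every residue class modulo \<open>\<pi>\<close> contains a natural number below \<open>p\<close>, which is a unit
  unless it is 0.\<close>

lemma Api_nonunit:
  assumes a: "a \<in> Api \<pi>" "absv a < 1"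
  shows "\<exists>b\<in>Api \<pi>. a = \<pi> * b"
proof -
  have "\<exists>k<p. \<exists>b\<in>Api \<pi>. a = of_nat k + \<pi> * b"
    using a(1)
  proof (induction rule: Api_induct)
    case 0
    then show ?case using p_gt_1 zero_in_Api by (intro exI[of _ 0]) auto
  next
    case (step z b)
    obtain k w where kw: "w \<in> Zp" "k < p" "z = of_nat k + of_nat p * w"
      using Zp_digit step(1) by blast
    obtain v where v: "v \<in> Api \<pi>" "of_nat p = \<pi> * v" using p_multiple_of_pi by blast
    have "z + \<pi> * b = of_nat k + \<pi> * (v * w + b)"
      unfolding kw(3) v(2) by (simp add: algebra_simps)
    moreover have "v * w + b \<in> Api \<pi>"
      using v(1) kw(1) step(2) Zp_subset_Api by (blast intro: Api_add Api_mult)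
    ultimately show ?case using kw(2) by blast
  qed
  then obtain k b where kb: "k < p" "b \<in> Api \<pi>" "a = of_nat k + \<pi> * b" by blast
  have "absv (\<pi> * b) \<le> absv \<pi> * 1"
    unfolding absv_mult using absv_Api[OF kb(2)] by (rule mult_left_mono) simp
  then have *: "absv (\<pi> * b) < 1"
    using absv_pi_less_1 by simp
  have "of_nat k = a - \<pi> * b" using kb(3) by simp
  then have "absv (of_nat k :: 'a) \<le> max (absv a) (absv (\<pi> * b))"
    by (simp only: absv_diff)
  also have "\<dots> < 1" using a(2) * by simp
  finally have "absv (of_nat k :: 'a) < 1" .
  then have "int p dvd int k" using absv_int_eq_1[of "int k"] by auto
  then have "k = 0" using kb(1) by (metis int_dvd_int_iff nat_dvd_not_less neq0_conv)
  then show ?thesis using kb by auto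
qed

text \<open>Division with remainder by \<open>E\<close>, whose leading coefficient is a unit.\<close>

lemma Api_poly_low_degree:
  assumes "\<forall>i. Polynomial.coeff q i \<in> Zp"
  shows "\<exists>r. (\<forall>i. Polynomial.coeff r i \<in> Zp) \<and>
    (\<forall>i\<ge>Polynomial.degree E. Polynomial.coeff r i = 0) \<and> poly r \<pi> = poly q \<pi>"
  using assms
proof (induction q)
  case 0
  then show ?case by (intro exI[of _ 0]) auto
next
  case (pCons z q)
  then have z: "z \<in> Zp" and "\<forall>i. Polynomial.coeff q i \<in> Zp"
    by (metis coeff_pCons_0, metis coeff_pCons_Suc)
  then obtain r where r: "\<forall>i. Polynomial.coeff r i \<in> Zp"
    "\<forall>i\<ge>Polynomial.degree E. Polynomial.coeff r i = 0" "poly r \<pi> = poly q \<pi>"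
    using pCons.IH by blast
  define u where "u = Polynomial.lead_coeff E"
  define t where "t = pCons z r"
  define c where "c = Polynomial.coeff t (Polynomial.degree E) * inverse u"
  have u: "u \<in> Zp" "absv u = 1" using lead_coeff_unit by (simp_all add: u_def)
  then have "u \<noteq> 0" by auto
  have tZ: "\<forall>i. Polynomial.coeff t i \<in> Zp" using r(1) z by (simp add: t_def coeff_pCons')
  then have cZ: "- c \<in> Zp" unfolding c_def by (intro Zp_minus Zp_mult Zp_inverse u) auto
  define s where "s = t + Polynomial.smult (- c) E"
  have "Polynomial.coeff s i = 0" if "i \<ge> Polynomial.degree E" for i
  proof (cases "i = Polynomial.degree E")
    case True
    then show ?thesis using \<open>u \<noteq> 0\<close> by (simp add: s_def c_def mult.assoc flip: u_def)
  next
    case False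
    then have "i > Polynomial.degree E" "i - 1 \<ge> Polynomial.degree E" using that by auto
    then show ?thesis using r(2) by (simp add: s_def t_def coeff_pCons' coeff_eq_0)
  qed
  moreover have "\<forall>i. Polynomial.coeff s i \<in> Zp"
    using eisenstein tZ cZ unfolding s_def eisenstein_def coeff_add coeff_smult
    by (blast intro: Zp_add Zp_mult)
  moreover have "poly s \<pi> = poly (pCons z q) \<pi>"
    using r(3) by (simp add: s_def t_def root)
  ultimately show ?case by blast
qed

text \<open>By division with remainder the order consists of the values of polynomials of degree below that of
  \<open>E\<close>; Horner's scheme builds these values by finitely many continuous images of products with the
  compact \<open>Zp\<close>.\<close>

lemma compact_Api: "compact (Api \<pi>)"
proof -
  define S where "S k = {poly q \<pi> |q. (\<forall>i. Polynomial.coeff q i \<in> Zp) \<and>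
    (\<forall>i\<ge>k. Polynomial.coeff q i = 0)}" for k
  have "compact (S k)" for k
  proof (induction k)
    case 0
    have "S 0 = {0}"
    proof
      show "S 0 \<subseteq> {0}"
        unfolding S_def by (auto, metis coeff_0 poly_0 poly_eqI)
      show "{0} \<subseteq> S 0"
        unfolding S_def by (auto intro!: exI[of _ 0] simp: zero_in_Zp)
    qed
    then show ?case by simp
  next
    case (Suc k)
    have "S (Suc k) = (\<lambda>(z, s). z + \<pi> * s) ` (Zp \<times> S k)"
    proof (intro equalityI subsetI)
      fix x
      assume "x \<in> S (Suc k)"
      then obtain q where q: "x = poly q \<pi>" "\<forall>i. Polynomial.coeff q i \<in> Zp"
        "\<forall>i\<ge>Suc k. Polynomial.coeff q i = 0"
        unfolding S_def by blast
      obtain z q' where z: "q = pCons z q'" by (cases q)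
      have "z \<in> Zp" "\<forall>i. Polynomial.coeff q' i \<in> Zp" "\<forall>i\<ge>k. Polynomial.coeff q' i = 0"
        using q z by (metis coeff_pCons_0, metis coeff_pCons_Suc, metis coeff_pCons_Suc Suc_le_mono)
      then show "x \<in> (\<lambda>(z, s). z + \<pi> * s) ` (Zp \<times> S k)"
        unfolding q(1) z S_def by auto
    next
      fix x
      assume "x \<in> (\<lambda>(z, s). z + \<pi> * s) ` (Zp \<times> S k)"
      then obtain z q where q: "z \<in> Zp" "\<forall>i. Polynomial.coeff q i \<in> Zp"
        "\<forall>i\<ge>k. Polynomial.coeff q i = 0" "x = z + \<pi> * poly q \<pi>"
        unfolding S_def by auto
      then have "x = poly (pCons z q) \<pi> \<and> (\<forall>i. Polynomial.coeff (pCons z q) i \<in> Zp) \<and>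
          (\<forall>i\<ge>Suc k. Polynomial.coeff (pCons z q) i = 0)"
        by (auto simp: coeff_pCons')
      then show "x \<in> S (Suc k)" unfolding S_def by blast
    qed
    moreover have "continuous_on (Zp \<times> S k) (\<lambda>(z, s). z + \<pi> * s)"
      unfolding case_prod_unfold by (intro continuous_intros)
    ultimately show ?case
      using compact_continuous_image compact_Times[OF compact_Zp Suc] by metis
  qed
  moreover have "Api \<pi> = S (Polynomial.degree E)"
  proof (intro equalityI subsetI)
    fix x
    assume "x \<in> Api \<pi>"
    then obtain q where q: "x = poly q \<pi>" "\<forall>i. Polynomial.coeff q i \<in> Zp"
      unfolding Api_def by blast
    show "x \<in> S (Polynomial.degree E)"
      using Api_poly_low_degree[OF q(2)] unfolding S_def q(1) mem_Collect_eq by metis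
  qed (auto simp: S_def Api_def)
  ultimately show ?thesis by simp
qed

end

section \<open>Families tending to zero\<close>

text \<open>All that substitution into restricted power series requires of the coefficient ring: \<open>\<pi>\<close> is
  topologically nilpotent, and the compactness supplies limits in the ring and closed ideals.\<close>

locale compact_order =
  fixes \<pi> :: "'a::nonarch_field"
  assumes absv_pi: "absv \<pi> < 1" and compact_order: "compact (Api \<pi>)"
begin

abbreviation pow_ideal :: "nat \<Rightarrow> 'a set"
  where "pow_ideal k \<equiv> (\<lambda>x. \<pi> ^ k * x) ` Api \<pi>"

lemma pow_ideal_0 [simp]: "pow_ideal 0 = Api \<pi>"
  by simp

lemma absv_pow_ideal: "a \<in> pow_ideal k \<Longrightarrow> absv a \<le> absv \<pi> ^ k"
  using absv_Api_le_1[of \<pi>] absv_pi by (auto simp: absv_mult absv_power mult_left_le)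

lemma zero_in_pow_ideal: "0 \<in> pow_ideal k"
  using zero_in_Api by force

lemma pow_ideal_add: "a \<in> pow_ideal k \<Longrightarrow> b \<in> pow_ideal k \<Longrightarrow> a + b \<in> pow_ideal k"
  by (auto simp: image_iff simp flip: distrib_left intro: Api_add)

lemma pow_ideal_sum: "(\<And>i. i \<in> I \<Longrightarrow> f i \<in> pow_ideal k) \<Longrightarrow> sum f I \<in> pow_ideal k"
  by (induction I rule: infinite_finite_induct) (auto intro: zero_in_pow_ideal pow_ideal_add)

lemma pow_ideal_mult:
  assumes "a \<in> pow_ideal k" "b \<in> Api \<pi>"
  shows "a * b \<in> pow_ideal k" "b * a \<in> pow_ideal k"
proof -
  obtain c where c: "c \<in> Api \<pi>" "a = \<pi> ^ k * c" using assms(1) by blast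
  have "a * b = \<pi> ^ k * (c * b)" "b * a = \<pi> ^ k * (c * b)" by (simp_all add: c(2) mult_ac)
  moreover have "c * b \<in> Api \<pi>" using c(1) assms(2) by (rule Api_mult)
  ultimately show "a * b \<in> pow_ideal k" "b * a \<in> pow_ideal k" by blast+
qed

lemma pow_ideal_antimono: "k \<le> l \<Longrightarrow> pow_ideal l \<subseteq> pow_ideal k"
proof -
  assume "k \<le> l"
  then have "\<pi> ^ l = \<pi> ^ k * \<pi> ^ (l - k)"
    by (simp flip: power_add)
  moreover have "\<pi> ^ (l - k) * x \<in> Api \<pi>" if "x \<in> Api \<pi>" for x
    using that by (intro Api_mult Api_power pi_in_Api)
  ultimately show ?thesis by (auto simp: mult.assoc)
qed

lemma closed_pow_ideal: "closed (pow_ideal k)"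
  by (intro compact_imp_closed compact_continuous_image compact_order continuous_intros)

lemma infsum_in_pow_ideal:
  assumes "f summable_on UNIV" "\<And>i. f i \<in> pow_ideal k"
  shows "infsum f UNIV \<in> pow_ideal k"
proof -
  have "(sum f \<longlongrightarrow> infsum f UNIV) (finite_subsets_at_top UNIV)"
    using assms(1) by (simp add: summable_iff_has_sum_infsum has_sum_def)
  moreover have "\<forall>\<^sub>F F in finite_subsets_at_top UNIV. sum f F \<in> pow_ideal k"
    by (intro always_eventually allI pow_ideal_sum assms(2))
  ultimately show ?thesis
    using Lim_in_closed_set[OF closed_pow_ideal] finite_subsets_at_top_neq_bot by blast
qed

text \<open>The coefficients of a restricted power series form such a family. Index types are arbitrary because
  double series, indexed by pairs of monomials, are rearranged below.\<close>

definition null_family :: "('i \<Rightarrow> 'a) \<Rightarrow> bool"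
  where "null_family f \<longleftrightarrow> (\<forall>i. f i \<in> Api \<pi>) \<and> (\<forall>k. finite {i. f i \<notin> pow_ideal k})"

lemma null_familyD:
  assumes "null_family f"
  shows "f i \<in> Api \<pi>" "finite {i. f i \<notin> pow_ideal k}"
  using assms by (auto simp: null_family_def)

text \<open>The partial sums over the finite sets of indices with term outside the \<open>k\<close>-th ideal form a
  Cauchy sequence, and the terms left out change a sum only within that ideal.\<close>

lemma null_family_summable:
  assumes f: "null_family f"
  shows "f summable_on UNIV"
proof -
  define L where "L k = {i. f i \<notin> pow_ideal k}" for k
  define s where "s k = sum f (L k)" for k
  have fin: "finite (L k)" for k using null_familyD(2)[OF f] by (simp add: L_def)
  have tail: "dist (sum f Y) (s k) \<le> absv \<pi> ^ k" if "finite Y" "L k \<subseteq> Y" for Y k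
  proof -
    have "sum f Y - s k = sum f (Y - L k)"
      unfolding s_def using that by (simp add: sum_diff)
    moreover have "sum f (Y - L k) \<in> pow_ideal k"
      by (rule pow_ideal_sum) (auto simp: L_def)
    ultimately show ?thesis
      unfolding dist_absv using absv_pow_ideal by simp
  qed
  have small: "\<exists>k. absv \<pi> ^ k < e" if "e > 0" for e
    using real_arch_pow_inv[OF that absv_pi] .
  have mono: "L k \<subseteq> L l" if "k \<le> l" for k l
    using pow_ideal_antimono[OF that] by (auto simp: L_def)
  have "Cauchy s"
    unfolding Cauchy_altdef2
  proof (intro allI impI)
    fix e :: real
    assume "e > 0"
    then obtain k where k: "absv \<pi> ^ k < e" using small by blast
    have "dist (s l) (s k) < e" if "l \<ge> k" for l
      using tail[OF fin mono[OF that]] k unfolding s_def by (meson le_less_trans)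
    then show "\<exists>k. \<forall>l\<ge>k. dist (s l) (s k) < e" by blast
  qed
  moreover have "complete (Api \<pi>)" using compact_order by (rule compact_imp_complete)
  moreover have "s k \<in> Api \<pi>" for k
    unfolding s_def using null_familyD(1)[OF f] by (intro Api_sum)
  ultimately obtain x where x: "s \<longlonglongrightarrow> x"
    unfolding complete_def by blast
  have "(f has_sum x) UNIV"
    unfolding has_sum_def tendsto_iff eventually_finite_subsets_at_top
  proof (intro allI impI)
    fix e :: real
    assume "e > 0"
    then obtain k where k: "absv \<pi> ^ k < e / 2" using small[of "e / 2"] by auto
    obtain N where N: "\<And>n. n \<ge> N \<Longrightarrow> dist (s n) x < e / 2"
      using x \<open>e > 0\<close> unfolding lim_sequentially by (meson half_gt_zero)
    \<comment> \<open>Far enough both for the tail beyond \<open>L l\<close> and for the partial sum \<open>s l\<close> to be within half of \<open>e\<close>.\<close>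
    define l where "l = max k N"
    have "absv \<pi> ^ l \<le> absv \<pi> ^ k"
      using absv_pi by (intro power_decreasing) (auto simp: l_def)
    then have "dist (sum f Y) x < e" if "finite Y" "L l \<subseteq> Y" for Y
      using dist_triangle[of "sum f Y" x "s l"] tail[OF that] k N[of l] by (simp add: l_def)
    then show "\<exists>I. finite I \<and> I \<subseteq> UNIV \<and>
        (\<forall>Y. finite Y \<and> I \<subseteq> Y \<and> Y \<subseteq> UNIV \<longrightarrow> dist (sum f Y) x < e)"
      using fin by blast
  qed
  then show ?thesis by (auto simp: summable_on_def)
qed

lemma null_family_infsum: "null_family f \<Longrightarrow> infsum f UNIV \<in> Api \<pi>"
  using infsum_in_pow_ideal[of f 0, OF null_family_summable] null_familyD(1)[of f] by simp

lemma null_family_has_sum: "null_family f \<Longrightarrow> (f has_sum infsum f UNIV) UNIV"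
  by (rule has_sum_infsum) (rule null_family_summable)

lemma null_family_reindex:
  assumes "null_family f" "inj h"
  shows "null_family (\<lambda>i. f (h i))"
proof -
  have "finite {i. f (h i) \<notin> pow_ideal k}" for k
    using finite_vimageI[OF null_familyD(2)[OF assms(1), of k] assms(2)] by (simp add: vimage_def)
  then show ?thesis using assms(1) by (simp add: null_family_def)
qed

text \<open>The family of all pairs is summable, so the sum may be taken one coordinate at a time.\<close>

lemma null_family_iterated_has_sum:
  assumes f: "null_family (\<lambda>(i, j). f i j)"
  shows "((\<lambda>i. infsum (f i) UNIV) has_sum infsum (\<lambda>(i, j). f i j) UNIV) UNIV"
proof (rule has_sum_SigmaD)
  show "((\<lambda>(i, j). f i j) has_sum infsum (\<lambda>(i, j). f i j) UNIV) (UNIV \<times> UNIV)"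
    using null_family_has_sum[OF f] by simp
  fix i
  have "null_family (\<lambda>j. case (i, j) of (i, j) \<Rightarrow> f i j)"
    using f by (rule null_family_reindex) (auto simp: inj_def)
  then show "((\<lambda>j. case (i, j) of (i, j) \<Rightarrow> f i j) has_sum infsum (f i) UNIV) UNIV"
    using null_family_has_sum by simp
qed

lemma null_family_infsum_swap:
  assumes f: "null_family (\<lambda>(i, j). f i j)"
  shows "(\<Sum>\<^sub>\<infinity>i. \<Sum>\<^sub>\<infinity>j. f i j) = (\<Sum>\<^sub>\<infinity>j. \<Sum>\<^sub>\<infinity>i. f i j)"
proof -
  have "null_family (\<lambda>x. (\<lambda>(i, j). f i j) (prod.swap x))"
    using f by (rule null_family_reindex) auto
  then have f': "null_family (\<lambda>(j, i). f i j)" by (simp add: case_prod_unfold)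
  have "((\<lambda>(j, i). f i j) has_sum infsum (\<lambda>(i, j). f i j) UNIV) UNIV"
    using null_family_has_sum[OF f] has_sum_swap[of "\<lambda>(i, j). f i j" UNIV UNIV]
    by (simp add: case_prod_unfold)
  then have "infsum (\<lambda>(j, i). f i j) UNIV = infsum (\<lambda>(i, j). f i j) UNIV" by (rule infsumI)
  then show ?thesis
    using infsumI[OF null_family_iterated_has_sum[OF f]] infsumI[OF null_family_iterated_has_sum[OF f']]
    by simp
qed

text \<open>Such double series arise when a series is evaluated after a substitution: the weights for a fixed \<open>i\<close>
  come from the coefficients of a polynomial, so only finitely many pairs lie outside a given ideal.\<close>

lemma null_family_weighted:
  assumes f: "null_family f" and w: "\<And>i j. f i \<noteq> 0 \<Longrightarrow> w i j \<in> Api \<pi>"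
    and fin: "\<And>i. finite {j. w i j \<noteq> 0}"
  shows "null_family (\<lambda>(i, j). f i * w i j)"
proof -
  have "f i * w i j \<in> Api \<pi>" for i j
    using null_familyD(1)[OF f] w[of i j] by (cases "f i = 0") (auto intro: zero_in_Api Api_mult)
  moreover have "finite {(i, j). f i * w i j \<notin> pow_ideal k}" for k
  proof (rule finite_subset)
    show "finite (SIGMA i:{i. f i \<notin> pow_ideal k}. {j. w i j \<noteq> 0})"
      using null_familyD(2)[OF f] fin by (rule finite_SigmaI)
    show "{(i, j). f i * w i j \<notin> pow_ideal k} \<subseteq> (SIGMA i:{i. f i \<notin> pow_ideal k}. {j. w i j \<noteq> 0})"
    proof
      fix x
      assume "x \<in> {(i, j). f i * w i j \<notin> pow_ideal k}"
      then obtain i j where x: "x = (i, j)" and "f i * w i j \<notin> pow_ideal k" by blast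
      moreover from this(2) have "f i \<noteq> 0" "w i j \<noteq> 0" using zero_in_pow_ideal[of k] by fastforce+
      ultimately show "x \<in> (SIGMA i:{i. f i \<notin> pow_ideal k}. {j. w i j \<noteq> 0})"
        using pow_ideal_mult(1)[of "f i" k "w i j"] w by blast
    qed
  qed
  ultimately show ?thesis by (auto simp: null_family_def case_prod_unfold)
qed

text \<open>The weights need only be integral where \<open>f\<close> does not vanish: a monomial in variables that a
  restricted series does not involve may be sent to anything.\<close>

lemma null_family_scale:
  assumes f: "null_family f" and w: "\<And>i. f i \<noteq> 0 \<Longrightarrow> w i \<in> Api \<pi>"
  shows "null_family (\<lambda>i. f i * w i)"
proof -
  have "f i * w i \<in> Api \<pi>" for i
    using null_familyD(1)[OF f] w[of i] by (cases "f i = 0") (auto intro: zero_in_Api Api_mult)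
  moreover have "f i * w i \<in> pow_ideal k" if "f i \<in> pow_ideal k" for i k
  proof (cases "f i = 0")
    case True
    then show ?thesis using zero_in_pow_ideal by simp
  next
    case False
    then show ?thesis using that w by (intro pow_ideal_mult(1))
  qed
  then have "{i. f i * w i \<notin> pow_ideal k} \<subseteq> {i. f i \<notin> pow_ideal k}" for k
    by (rule_tac Collect_mono) metis
  then have "finite {i. f i * w i \<notin> pow_ideal k}" for k
    using null_familyD(2)[OF f] finite_subset by metis
  ultimately show ?thesis
    unfolding null_family_def by simp
qed

lemma null_family_product:
  assumes f: "null_family f" and g: "null_family g"
  shows "null_family (\<lambda>(i, j). f i * g j)"
proof -
  have "finite {(i, j). f i * g j \<notin> pow_ideal k}" for k
  proof (rule finite_subset)
    show "finite ({i. f i \<notin> pow_ideal k} \<times> {j. g j \<notin> pow_ideal k})"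
      using null_familyD(2)[OF f] null_familyD(2)[OF g] by blast
    show "{(i, j). f i * g j \<notin> pow_ideal k} \<subseteq> {i. f i \<notin> pow_ideal k} \<times> {j. g j \<notin> pow_ideal k}"
      using pow_ideal_mult null_familyD(1)[OF f] null_familyD(1)[OF g] by blast
  qed
  then show ?thesis
    using null_familyD(1)[OF f] null_familyD(1)[OF g]
    by (auto simp: null_family_def case_prod_unfold intro: Api_mult)
qed

lemma infsum_product:
  assumes f: "null_family f" and g: "null_family g"
  shows "(\<Sum>\<^sub>\<infinity>(i, j). f i * g j) = infsum f UNIV * infsum g UNIV"
proof -
  have "(\<Sum>\<^sub>\<infinity>j. f i * g j) = f i * infsum g UNIV" for i
    by (rule infsumI) (rule has_sum_cmult_right[OF null_family_has_sum[OF g]])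
  moreover have "((\<lambda>i. f i * infsum g UNIV) has_sum infsum f UNIV * infsum g UNIV) UNIV"
    using has_sum_cmult_right[OF null_family_has_sum[OF f], of "infsum g UNIV"]
    by (simp add: mult.commute)
  ultimately show ?thesis
    using has_sum_unique null_family_iterated_has_sum[OF null_family_product[OF f g]] by simp
qed

end

section \<open>Monomials and polynomials in the word variables\<close>

text \<open>Both factors of a monomial have exponents bounded by those of the product.\<close>

lemma finite_mon_splits: "finite {(k, l). k + l = (m :: mon)}"
proof (rule finite_subset)
  define B where "B = {k :: mon. \<forall>\<mu>. Poly_Mapping.lookup k \<mu> \<le> Poly_Mapping.lookup m \<mu>}"
  define h where "h k = restrict (Poly_Mapping.lookup k) (Poly_Mapping.keys m)" for k :: mon
  have "h ` B \<subseteq> (\<Pi>\<^sub>E \<mu>\<in>Poly_Mapping.keys m. {..Poly_Mapping.lookup m \<mu>})"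
    by (auto simp: B_def h_def)
  then have "finite (h ` B)"
    by (rule finite_subset) (intro finite_PiE; simp)
  moreover have "inj_on h B"
  proof (intro inj_onI poly_mapping_eqI)
    fix k l \<mu>
    assume kl: "k \<in> B" "l \<in> B" "h k = h l"
    show "Poly_Mapping.lookup k \<mu> = Poly_Mapping.lookup l \<mu>"
    proof (cases "\<mu> \<in> Poly_Mapping.keys m")
      case True
      then show ?thesis using fun_cong[OF kl(3), of \<mu>] by (simp add: h_def)
    next
      case False
      then have "Poly_Mapping.lookup m \<mu> = 0" by (simp add: in_keys_iff)
      then show ?thesis using kl(1,2) unfolding B_def by (metis (mono_tags) le_zero_eq mem_Collect_eq)
    qed
  qed
  ultimately have "finite B" by (rule finite_imageD)
  then show "finite (B \<times> B)" by simp
  show "{(k, l). k + l = m} \<subseteq> B \<times> B" by (auto simp: B_def lookup_add)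
qed

lemma keys_add_mon: "Poly_Mapping.keys (k + l :: mon) = Poly_Mapping.keys k \<union> Poly_Mapping.keys l"
  by (auto simp: in_keys_iff lookup_add)

lemma eval_mon_superset:
  assumes "finite W" "Poly_Mapping.keys m \<subseteq> W"
  shows "eval_mon m x = (\<Prod>\<mu>\<in>W. x \<mu> ^ Poly_Mapping.lookup m \<mu>)"
  unfolding eval_mon_def using assms by (intro prod.mono_neutral_left) (auto simp: in_keys_iff)

lemma eval_mon_0 [simp]: "eval_mon 0 x = 1"
  by (simp add: eval_mon_def)

lemma eval_mon_single [simp]: "eval_mon (Poly_Mapping.single \<mu> 1) x = x \<mu>"
  by (simp add: eval_mon_def)

lemma eval_mon_add: "eval_mon (k + l) x = eval_mon k x * eval_mon l x"
proof -
  let ?W = "Poly_Mapping.keys k \<union> Poly_Mapping.keys l"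
  have "eval_mon (k + l) x = (\<Prod>\<mu>\<in>?W. x \<mu> ^ Poly_Mapping.lookup (k + l) \<mu>)"
    by (intro eval_mon_superset) (auto simp: keys_add_mon)
  also have "\<dots> = (\<Prod>\<mu>\<in>?W. x \<mu> ^ Poly_Mapping.lookup k \<mu>) * (\<Prod>\<mu>\<in>?W. x \<mu> ^ Poly_Mapping.lookup l \<mu>)"
    by (simp add: lookup_add power_add prod.distrib)
  also have "\<dots> = eval_mon k x * eval_mon l x"
    by (subst (1 2) eval_mon_superset[of ?W]) auto
  finally show ?thesis .
qed

lemma lookup_times_mon:
  fixes P Q :: "mon \<Rightarrow>\<^sub>0 'a::comm_ring_1"
  shows "Poly_Mapping.lookup (P * Q) m =
    (\<Sum>(s, t) | s + t = m. Poly_Mapping.lookup P s * Poly_Mapping.lookup Q t)"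
proof -
  let ?h = "\<lambda>(s, t). Poly_Mapping.lookup P s * Poly_Mapping.lookup Q t when m = s + t"
  have "Poly_Mapping.lookup (P * Q) m = Sum_any ?h"
    unfolding times_poly_mapping.rep_eq by (rule prod_fun_unfold_prod) auto
  also have "\<dots> = sum ?h {(s, t). s + t = m}"
    by (rule Sum_any.expand_superset) (auto simp: finite_mon_splits)
  also have "\<dots> = (\<Sum>(s, t) | s + t = m. Poly_Mapping.lookup P s * Poly_Mapping.lookup Q t)"
    by (rule sum.cong) auto
  finally show ?thesis .
qed

text \<open>Polynomials are finitely supported, so evaluation is a ring homomorphism at arbitrary values of the
  variables, without any question of convergence.\<close>

definition poly_eval :: "(nat list \<Rightarrow> 'a) \<Rightarrow> (mon \<Rightarrow>\<^sub>0 'a) \<Rightarrow> 'a::comm_ring_1"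
  where "poly_eval x P = (\<Sum>m\<in>Poly_Mapping.keys P. Poly_Mapping.lookup P m * eval_mon m x)"

lemma poly_eval_superset:
  assumes "finite M" "Poly_Mapping.keys P \<subseteq> M"
  shows "poly_eval x P = (\<Sum>m\<in>M. Poly_Mapping.lookup P m * eval_mon m x)"
  unfolding poly_eval_def using assms by (intro sum.mono_neutral_left) (auto simp: in_keys_iff)

lemma poly_eval_0 [simp]: "poly_eval x 0 = 0"
  by (simp add: poly_eval_def)

lemma poly_eval_single [simp]: "poly_eval x (Poly_Mapping.single m c) = c * eval_mon m x"
  by (cases "c = 0") (simp_all add: poly_eval_def)

lemma poly_eval_1 [simp]: "poly_eval x 1 = 1"
  by (simp flip: single_one)

lemma poly_eval_add: "poly_eval x (P + Q) = poly_eval x P + poly_eval x Q"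
proof -
  let ?M = "Poly_Mapping.keys P \<union> Poly_Mapping.keys Q"
  have "poly_eval x (P + Q) = (\<Sum>m\<in>?M. Poly_Mapping.lookup (P + Q) m * eval_mon m x)"
    using keys_add[of P Q] by (intro poly_eval_superset) auto
  also have "\<dots> = poly_eval x P + poly_eval x Q"
    by (subst (1 2) poly_eval_superset[of ?M]) (auto simp: lookup_add distrib_right sum.distrib)
  finally show ?thesis .
qed

lemma poly_eval_sum: "poly_eval x (sum f I) = (\<Sum>i\<in>I. poly_eval x (f i))"
  by (induction I rule: infinite_finite_induct) (auto simp: poly_eval_add)

lemma poly_as_sum:
  "P = (\<Sum>m\<in>Poly_Mapping.keys P. Poly_Mapping.single m (Poly_Mapping.lookup P m))"
  by (rule poly_mapping_eqI)
    (auto simp: lookup_sum lookup_single when_def in_keys_iff if_distrib sum.delta cong: if_cong)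

lemma poly_eval_mult: "poly_eval x (P * Q) = poly_eval x P * poly_eval x Q"
proof -
  let ?s = "\<lambda>P m. Poly_Mapping.single m (Poly_Mapping.lookup P m)"
  have "P * Q = (\<Sum>m\<in>Poly_Mapping.keys P. \<Sum>l\<in>Poly_Mapping.keys Q. ?s P m * ?s Q l)"
    by (subst poly_as_sum[of P], subst poly_as_sum[of Q]) (simp add: sum_product)
  then have "poly_eval x (P * Q) = (\<Sum>m\<in>Poly_Mapping.keys P. \<Sum>l\<in>Poly_Mapping.keys Q.
      (Poly_Mapping.lookup P m * eval_mon m x) * (Poly_Mapping.lookup Q l * eval_mon l x))"
    by (simp add: poly_eval_sum mult_single eval_mon_add mult_ac)
  then show ?thesis by (simp add: poly_eval_def sum_product)
qed

lemma poly_eval_power: "poly_eval x (P ^ k) = poly_eval x P ^ k"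
  by (induction k) (auto simp: poly_eval_mult)

lemma poly_eval_prod: "poly_eval x (prod f I) = (\<Prod>i\<in>I. poly_eval x (f i))"
  by (induction I rule: infinite_finite_induct) (auto simp: poly_eval_mult)

lemma poly_eval_eval_mon: "poly_eval x (eval_mon k g) = eval_mon k (\<lambda>\<mu>. poly_eval x (g \<mu>))"
  by (simp add: eval_mon_def poly_eval_prod poly_eval_power)

text \<open>Coefficients are constrained on all monomials, so \<open>A\<close> must contain 0 for this to be nonempty; for a
  subring \<open>A\<close> it is the polynomial ring over \<open>A\<close> in the variables from \<open>W\<close>.\<close>

definition polys_in :: "'a::comm_ring_1 set \<Rightarrow> nat list set \<Rightarrow> (mon \<Rightarrow>\<^sub>0 'a) set"
  where "polys_in A W = {P. range (Poly_Mapping.lookup P) \<subseteq> A \<and>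
    (\<forall>m\<in>Poly_Mapping.keys P. Poly_Mapping.keys m \<subseteq> W)}"

lemma polys_in_single:
  "c \<in> Api \<pi> \<Longrightarrow> Poly_Mapping.keys m \<subseteq> W \<Longrightarrow> Poly_Mapping.single m c \<in> polys_in (Api (\<pi>::'a::nonarch_field)) W"
  by (auto simp: polys_in_def lookup_single when_def zero_in_Api split: if_splits)

lemma polys_in_1: "1 \<in> polys_in (Api (\<pi>::'a::nonarch_field)) W"
  using polys_in_single[of 1 \<pi> 0 W] one_in_Api[of \<pi>] by simp

lemma polys_in_add:
  assumes "P \<in> polys_in (Api \<pi>) W" "Q \<in> polys_in (Api \<pi>) W"
  shows "P + Q \<in> polys_in (Api (\<pi>::'a::nonarch_field)) W"
proof -
  have "Poly_Mapping.lookup (P + Q) m \<in> Api \<pi>" for m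
    using assms by (auto simp: polys_in_def lookup_add intro!: Api_add)
  moreover have "Poly_Mapping.keys m \<subseteq> W" if "m \<in> Poly_Mapping.keys (P + Q)" for m
    using that keys_add[of P Q] assms unfolding polys_in_def by blast
  ultimately show ?thesis by (auto simp: polys_in_def)
qed

lemma polys_in_sum:
  "(\<And>i. i \<in> I \<Longrightarrow> f i \<in> polys_in (Api \<pi>) W) \<Longrightarrow> sum f I \<in> polys_in (Api (\<pi>::'a::nonarch_field)) W"
proof (induction I rule: infinite_finite_induct)
  case (insert i I)
  then show ?case by (simp add: polys_in_add)
qed (auto simp: polys_in_def zero_in_Api)

lemma polys_in_mult:
  assumes "P \<in> polys_in (Api \<pi>) W" "Q \<in> polys_in (Api \<pi>) W"
  shows "P * Q \<in> polys_in (Api (\<pi>::'a::nonarch_field)) W"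
proof -
  have "Poly_Mapping.lookup (P * Q) m \<in> Api \<pi>" for m
    unfolding lookup_times_mon using assms
    by (intro Api_sum) (auto simp: polys_in_def intro!: Api_mult)
  moreover have "Poly_Mapping.keys m \<subseteq> W" if "m \<in> Poly_Mapping.keys (P * Q)" for m
  proof -
    obtain k l where "m = k + l" "k \<in> Poly_Mapping.keys P" "l \<in> Poly_Mapping.keys Q"
      using \<open>m \<in> Poly_Mapping.keys (P * Q)\<close> keys_mult[of P Q] by blast
    then show ?thesis using assms by (simp add: polys_in_def keys_add_mon)
  qed
  ultimately show ?thesis by (auto simp: polys_in_def)
qed

lemma polys_in_power: "P \<in> polys_in (Api \<pi>) W \<Longrightarrow> P ^ k \<in> polys_in (Api (\<pi>::'a::nonarch_field)) W"
  by (induction k) (auto intro: polys_in_1 polys_in_mult)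

lemma polys_in_prod:
  "(\<And>i. i \<in> I \<Longrightarrow> f i \<in> polys_in (Api \<pi>) W) \<Longrightarrow> prod f I \<in> polys_in (Api (\<pi>::'a::nonarch_field)) W"
proof (induction I rule: infinite_finite_induct)
  case (insert i I)
  then show ?case by (simp add: polys_in_mult)
qed (simp_all add: polys_in_1)

lemma polys_in_eval_mon:
  assumes "\<And>\<mu>. \<mu> \<in> W \<Longrightarrow> g \<mu> \<in> polys_in (Api \<pi>) W" "Poly_Mapping.keys k \<subseteq> W"
  shows "eval_mon k g \<in> polys_in (Api (\<pi>::'a::nonarch_field)) W"
  unfolding eval_mon_def using assms by (intro polys_in_prod polys_in_power) auto

lemma polys_inD:
  assumes "P \<in> polys_in A W"
  shows "Poly_Mapping.lookup P m \<in> A" "Poly_Mapping.lookup P m \<noteq> 0 \<Longrightarrow> Poly_Mapping.keys m \<subseteq> W"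
  using assms by (auto simp: polys_in_def in_keys_iff)

lemma eval_mon_in_Api:
  "(\<And>\<mu>. \<mu> \<in> Poly_Mapping.keys m \<Longrightarrow> x \<mu> \<in> Api \<pi>) \<Longrightarrow> eval_mon m x \<in> Api (\<pi>::'a::nonarch_field)"
  unfolding eval_mon_def by (intro Api_prod Api_power)

section \<open>Substitution into restricted power series\<close>

context compact_order
begin

lemma restricted_ring_carrier_iff:
  "F \<in> carrier (restricted_ring \<pi> n r) \<longleftrightarrow>
    null_family F \<and> (\<forall>m. F m \<noteq> 0 \<longrightarrow> Poly_Mapping.keys m \<subseteq> words n r)"
  by (auto simp: restricted_ring_def null_family_def)

lemma has_sum_finite_sum:
  fixes f :: "'i \<Rightarrow> 'j \<Rightarrow> 'a"
  assumes "finite I" "\<And>i. i \<in> I \<Longrightarrow> (f i has_sum s i) UNIV"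
  shows "((\<lambda>x. \<Sum>i\<in>I. f i x) has_sum (\<Sum>i\<in>I. s i)) UNIV"
  using assms by (induction I rule: finite_induct) (auto intro: has_sum_add has_sum_0)

text \<open>Summing over all pairs of monomials amounts to summing first over the pairs with a given
  product.\<close>

lemma has_sum_by_product:
  fixes h :: "mon \<Rightarrow> mon \<Rightarrow> 'a"
  assumes h: "null_family (\<lambda>(a, b). h a b)"
  shows "((\<lambda>m. \<Sum>(a, b) | a + b = m. h a b) has_sum (\<Sum>\<^sub>\<infinity>(a, b). h a b)) UNIV"
proof (rule has_sum_SigmaD)
  let ?D = "\<lambda>m :: mon. {(a, b). a + b = m}"
  let ?s = "\<lambda>x :: mon \<times> mon. (fst x + snd x, x)"
  let ?f = "\<lambda>y :: mon \<times> mon \<times> mon. h (fst (snd y)) (snd (snd y))"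
  have inj: "inj ?s" by (auto simp: inj_def)
  have range: "range ?s = Sigma UNIV ?D"
  proof (intro equalityI subsetI)
    fix y
    assume "y \<in> Sigma UNIV ?D"
    then have "y = ?s (snd y)" by auto
    then show "y \<in> range ?s" by blast
  qed auto
  have "((?f \<circ> ?s) has_sum (\<Sum>\<^sub>\<infinity>(a, b). h a b)) UNIV"
    using null_family_has_sum[OF h] by (simp add: o_def case_prod_unfold)
  then show "(?f has_sum (\<Sum>\<^sub>\<infinity>(a, b). h a b)) (Sigma UNIV ?D)"
    unfolding range[symmetric] has_sum_reindex[OF inj] .
  show "((\<lambda>x. ?f (m, x)) has_sum (\<Sum>(a, b) | a + b = m. h a b)) (?D m)" for m
    by (rule has_sum_finiteI[OF finite_mon_splits]) (simp add: case_prod_unfold)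
qed

context
  fixes n r :: nat and g :: "nat list \<Rightarrow> (mon \<Rightarrow>\<^sub>0 'a)"
  assumes g: "\<And>\<mu>. \<mu> \<in> words n r \<Longrightarrow> g \<mu> \<in> polys_in (Api \<pi>) (words n r)"
begin

text \<open>The matrix of the substitution on monomials: the coefficient at \<open>m\<close> of the image of the monomial \<open>k\<close>.\<close>

definition subst_coeff :: "mon \<Rightarrow> mon \<Rightarrow> 'a"
  where "subst_coeff k m = Poly_Mapping.lookup (eval_mon k g) m"

lemma subst_series_eq: "subst_series g F m = (\<Sum>\<^sub>\<infinity>k. F k * subst_coeff k m)"
  by (simp add: subst_series_def subst_coeff_def)

lemma subst_coeff_in_Api: "Poly_Mapping.keys k \<subseteq> words n r \<Longrightarrow> subst_coeff k m \<in> Api \<pi>"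
  unfolding subst_coeff_def using polys_in_eval_mon[of "words n r" g \<pi> k] g by (blast intro: polys_inD)

lemma subst_coeff_keys:
  "Poly_Mapping.keys k \<subseteq> words n r \<Longrightarrow> subst_coeff k m \<noteq> 0 \<Longrightarrow> Poly_Mapping.keys m \<subseteq> words n r"
  unfolding subst_coeff_def using polys_in_eval_mon[of "words n r" g \<pi> k] g by (blast dest: polys_inD)

lemma finite_subst_coeff: "finite {m. subst_coeff k m \<noteq> 0}"
  unfolding subst_coeff_def by simp

lemma subst_coeff_add:
  "subst_coeff (k + l) m = (\<Sum>(s, t) | s + t = m. subst_coeff k s * subst_coeff l t)"
  unfolding subst_coeff_def eval_mon_add lookup_times_mon ..

lemma null_family_subst:
  "F \<in> carrier (restricted_ring \<pi> n r) \<Longrightarrow> null_family (\<lambda>k. F k * subst_coeff k m)"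
  unfolding restricted_ring_carrier_iff by (auto intro!: null_family_scale subst_coeff_in_Api)

lemma subst_series_has_sum:
  "F \<in> carrier (restricted_ring \<pi> n r) \<Longrightarrow> ((\<lambda>k. F k * subst_coeff k m) has_sum subst_series g F m) UNIV"
  unfolding subst_series_eq by (rule null_family_has_sum) (rule null_family_subst)

text \<open>A coefficient of the substituted series outside the \<open>N\<close>-th ideal comes from one of the
  finitely many terms of \<open>F\<close> outside it, each of which is replaced by a polynomial.\<close>

lemma subst_series_carrier:
  assumes F: "F \<in> carrier (restricted_ring \<pi> n r)"
  shows "subst_series g F \<in> carrier (restricted_ring \<pi> n r)"
proof -
  have nF: "null_family F" and kF: "\<And>m. F m \<noteq> 0 \<Longrightarrow> Poly_Mapping.keys m \<subseteq> words n r"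
    using F by (auto simp: restricted_ring_carrier_iff)
  have "finite {m. subst_series g F m \<notin> pow_ideal N}" for N
  proof (rule finite_subset)
    let ?U = "\<Union>k\<in>{k. F k \<notin> pow_ideal N}. {m. subst_coeff k m \<noteq> 0}"
    show "finite ?U" using null_familyD(2)[OF nF] finite_subst_coeff by blast
    show "{m. subst_series g F m \<notin> pow_ideal N} \<subseteq> ?U"
    proof (rule subsetI, rule ccontr)
      fix m
      assume m: "m \<in> {m. subst_series g F m \<notin> pow_ideal N}" "m \<notin> ?U"
      have "F k * subst_coeff k m \<in> pow_ideal N" for k
      proof (cases "F k = 0 \<or> subst_coeff k m = 0")
        case True
        then show ?thesis using zero_in_pow_ideal[of N] by auto
      next
        case False
        then have "F k \<in> pow_ideal N" "subst_coeff k m \<in> Api \<pi>"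
          using m(2) kF subst_coeff_in_Api by blast+
        then show ?thesis by (rule pow_ideal_mult)
      qed
      then have "subst_series g F m \<in> pow_ideal N"
        unfolding subst_series_eq
        by (rule infsum_in_pow_ideal[OF null_family_summable[OF null_family_subst[OF F]]])
      then show False using m(1) by blast
    qed
  qed
  moreover have "subst_series g F m \<in> Api \<pi>" for m
    unfolding subst_series_eq by (rule null_family_infsum[OF null_family_subst[OF F]])
  moreover have "Poly_Mapping.keys m \<subseteq> words n r" if "subst_series g F m \<noteq> 0" for m
  proof (rule ccontr)
    assume "\<not> Poly_Mapping.keys m \<subseteq> words n r"
    then have "F k * subst_coeff k m = 0" for k
      using kF[of k] subst_coeff_keys[of k m] by (cases "F k = 0") auto
    then have "subst_series g F m = 0" unfolding subst_series_eq by (intro infsum_0) simp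
    with that show False by simp
  qed
  ultimately show ?thesis
    unfolding restricted_ring_carrier_iff null_family_def by blast
qed

lemma subst_series_add:
  assumes "F \<in> carrier (restricted_ring \<pi> n r)" "G \<in> carrier (restricted_ring \<pi> n r)"
  shows "subst_series g (\<lambda>m. F m + G m) m = subst_series g F m + subst_series g G m"
proof -
  have "((\<lambda>k. F k * subst_coeff k m + G k * subst_coeff k m) has_sum
      (subst_series g F m + subst_series g G m)) UNIV"
    by (intro has_sum_add subst_series_has_sum assms)
  then show ?thesis
    unfolding subst_series_eq[of "\<lambda>m. F m + G m"] by (intro infsumI) (simp add: distrib_right)
qed

text \<open>The double sum over the monomials of \<open>F\<close> and \<open>G\<close> can be grouped by their product, which gives the
  substitution into the product series, or be expanded by multiplicativity of the substitution on
  monomials, which gives the product of the two substitutions, coefficient by coefficient.\<close>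

lemma subst_series_mult:
  assumes F: "F \<in> carrier (restricted_ring \<pi> n r)" and G: "G \<in> carrier (restricted_ring \<pi> n r)"
  shows "subst_series g (\<lambda>m. \<Sum>(k, l) | k + l = m. F k * G l) m =
    (\<Sum>(s, t) | s + t = m. subst_series g F s * subst_series g G t)"
proof -
  have nF: "null_family F" "null_family G"
    and kF: "\<And>m. F m \<noteq> 0 \<Longrightarrow> Poly_Mapping.keys m \<subseteq> words n r"
      "\<And>m. G m \<noteq> 0 \<Longrightarrow> Poly_Mapping.keys m \<subseteq> words n r"
    using F G by (auto simp: restricted_ring_carrier_iff)
  let ?h = "\<lambda>a b. F a * G b * subst_coeff (a + b) m"
  have "null_family (\<lambda>x. (case x of (a, b) \<Rightarrow> F a * G b) * (case x of (a, b) \<Rightarrow> subst_coeff (a + b) m))"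
  proof (rule null_family_scale[OF null_family_product[OF nF]])
    fix x
    assume "(case x of (a, b) \<Rightarrow> F a * G b) \<noteq> 0"
    then show "(case x of (a, b) \<Rightarrow> subst_coeff (a + b) m) \<in> Api \<pi>"
      using kF(1)[of "fst x"] kF(2)[of "snd x"]
      by (cases x) (simp add: keys_add_mon subst_coeff_in_Api)
  qed
  then have h: "null_family (\<lambda>(a, b). ?h a b)" by (simp add: case_prod_unfold)
  have "subst_series g (\<lambda>m. \<Sum>(k, l) | k + l = m. F k * G l) m =
      (\<Sum>\<^sub>\<infinity>c. \<Sum>(a, b) | a + b = c. ?h a b)"
    unfolding subst_series_eq by (rule infsum_cong) (auto simp: sum_distrib_right intro!: sum.cong)
  also have "\<dots> = (\<Sum>\<^sub>\<infinity>(a, b). ?h a b)"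
    by (rule infsumI) (rule has_sum_by_product[OF h])
  also have "\<dots> = (\<Sum>\<^sub>\<infinity>x. \<Sum>(s, t) | s + t = m.
      case x of (a, b) \<Rightarrow> (F a * subst_coeff a s) * (G b * subst_coeff b t))"
    by (rule infsum_cong) (auto simp: subst_coeff_add sum_distrib_left mult_ac intro!: sum.cong)
  also have "\<dots> = (\<Sum>(s, t) | s + t = m. subst_series g F s * subst_series g G t)"
  proof (rule infsumI)
    have "((\<lambda>(a, b). (F a * subst_coeff a s) * (G b * subst_coeff b t)) has_sum
        subst_series g F s * subst_series g G t) UNIV" for s t
      unfolding subst_series_eq
      using null_family_has_sum[OF null_family_product[OF null_family_subst[OF F] null_family_subst[OF G]]]
      by (simp add: infsum_product null_family_subst F G)
    then show "((\<lambda>x. \<Sum>(s, t) | s + t = m.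
        case x of (a, b) \<Rightarrow> (F a * subst_coeff a s) * (G b * subst_coeff b t)) has_sum
        (\<Sum>(s, t) | s + t = m. subst_series g F s * subst_series g G t)) UNIV"
      using finite_mon_splits[of m] unfolding case_prod_unfold by (intro has_sum_finite_sum)
  qed
  finally show ?thesis .
qed

lemma subst_series_const: "subst_series g (const_series c) = const_series c"
proof
  fix m
  have "(\<Sum>\<^sub>\<infinity>k. const_series c k * subst_coeff k m) = (\<Sum>k\<in>{0}. const_series c k * subst_coeff k m)"
    by (rule infsumI, rule has_sum_finite_neutralI[of "{0}"]) (auto simp: const_series_def)
  then show "subst_series g (const_series c) m = const_series c m"
    by (simp add: subst_series_eq const_series_def subst_coeff_def lookup_one when_def)
qed

lemma subst_series_var: "subst_series g (var_series \<mu>) = Poly_Mapping.lookup (g \<mu>)"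
proof
  fix m
  let ?k = "Poly_Mapping.single \<mu> (1::nat)"
  have "(\<Sum>\<^sub>\<infinity>k. var_series \<mu> k * subst_coeff k m) = (\<Sum>k\<in>{?k}. var_series \<mu> k * subst_coeff k m)"
    by (rule infsumI, rule has_sum_finite_neutralI[of "{?k}"]) (auto simp: var_series_def)
  then show "subst_series g (var_series \<mu>) m = Poly_Mapping.lookup (g \<mu>) m"
    using eval_mon_single[of \<mu> g] by (simp add: subst_series_eq var_series_def subst_coeff_def)
qed

lemma restricted_alg_hom_subst_series: "restricted_alg_hom \<pi> n r (subst_series g)"
  unfolding restricted_alg_hom_def
proof (intro conjI ballI ring_hom_memI)
  fix F G
  assume FG: "F \<in> carrier (restricted_ring \<pi> n r)" "G \<in> carrier (restricted_ring \<pi> n r)"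
  show "subst_series g (F \<otimes>\<^bsub>restricted_ring \<pi> n r\<^esub> G) =
      subst_series g F \<otimes>\<^bsub>restricted_ring \<pi> n r\<^esub> subst_series g G"
    using subst_series_mult[OF FG] by (simp add: restricted_ring_def fun_eq_iff)
  show "subst_series g (F \<oplus>\<^bsub>restricted_ring \<pi> n r\<^esub> G) =
      subst_series g F \<oplus>\<^bsub>restricted_ring \<pi> n r\<^esub> subst_series g G"
    using subst_series_add[OF FG] by (simp add: restricted_ring_def fun_eq_iff)
next
  show "subst_series g \<one>\<^bsub>restricted_ring \<pi> n r\<^esub> = \<one>\<^bsub>restricted_ring \<pi> n r\<^esub>"
    by (simp add: restricted_ring_def subst_series_const)
qed (auto intro: subst_series_carrier subst_series_const)

text \<open>Exchanging the sum over the monomials \<open>k\<close> of \<open>F\<close> with the sum over the monomials \<open>m\<close> of the substituted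
  series leaves, for each \<open>k\<close>, a finite sum: the value of the polynomial that replaces \<open>k\<close>.\<close>

lemma eval_series_subst_series:
  assumes F: "F \<in> carrier (restricted_ring \<pi> n r)"
    and x: "\<And>\<mu>. \<mu> \<in> words n r \<Longrightarrow> x \<mu> \<in> Api \<pi>"
  shows "eval_series (subst_series g F) x = eval_series F (\<lambda>\<mu>. poly_eval x (g \<mu>))"
proof -
  have nF: "null_family F" and kF: "\<And>m. F m \<noteq> 0 \<Longrightarrow> Poly_Mapping.keys m \<subseteq> words n r"
    using F by (auto simp: restricted_ring_carrier_iff)
  let ?w = "\<lambda>k m. subst_coeff k m * eval_mon m x"
  have null: "null_family (\<lambda>(k, m). F k * ?w k m)"
  proof (rule null_family_weighted[OF nF])
    fix k m
    assume k: "F k \<noteq> 0"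
    show "?w k m \<in> Api \<pi>"
    proof (cases "subst_coeff k m = 0")
      case False
      then show ?thesis
        using subst_coeff_in_Api[OF kF[OF k]] subst_coeff_keys[OF kF[OF k]] x
        by (intro Api_mult eval_mon_in_Api) auto
    qed (simp add: zero_in_Api)
  next
    show "finite {m. ?w k m \<noteq> 0}" for k
      by (rule finite_subset[OF _ finite_subst_coeff[of k]]) auto
  qed
  have "subst_series g F m * eval_mon m x = (\<Sum>\<^sub>\<infinity>k. F k * ?w k m)" for m
    using infsumI[OF has_sum_cmult_left[OF subst_series_has_sum[OF F]]] by (simp add: mult.assoc)
  then have "eval_series (subst_series g F) x = (\<Sum>\<^sub>\<infinity>m. \<Sum>\<^sub>\<infinity>k. F k * ?w k m)"
    by (simp add: eval_series_def)
  also have "\<dots> = (\<Sum>\<^sub>\<infinity>k. \<Sum>\<^sub>\<infinity>m. F k * ?w k m)"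
    using null_family_infsum_swap[OF null] by simp
  also have "\<dots> = (\<Sum>\<^sub>\<infinity>k. F k * eval_mon k (\<lambda>\<mu>. poly_eval x (g \<mu>)))"
  proof (rule infsum_cong)
    fix k
    have "((\<lambda>m. ?w k m) has_sum poly_eval x (eval_mon k g)) UNIV"
      by (rule has_sum_finite_neutralI[of "Poly_Mapping.keys (eval_mon k g)"])
        (auto simp: subst_coeff_def poly_eval_def in_keys_iff)
    then have "((\<lambda>m. F k * ?w k m) has_sum F k * poly_eval x (eval_mon k g)) UNIV"
      by (rule has_sum_cmult_right)
    then show "(\<Sum>\<^sub>\<infinity>m. F k * ?w k m) = F k * eval_mon k (\<lambda>\<mu>. poly_eval x (g \<mu>))"
      unfolding poly_eval_eval_mon[symmetric] by (rule infsumI)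
  qed
  finally show ?thesis by (simp add: eval_series_def)
qed

end

lemma eval_series_in_Api:
  assumes "F \<in> carrier (restricted_ring \<pi> n r)" "\<And>\<mu>. \<mu> \<in> words n r \<Longrightarrow> x \<mu> \<in> Api \<pi>"
  shows "eval_series F x \<in> Api \<pi>"
  unfolding eval_series_def
proof (rule null_family_infsum, rule null_family_scale)
  show "null_family F" using assms(1) by (simp add: restricted_ring_carrier_iff)
  show "eval_mon m x \<in> Api \<pi>" if "F m \<noteq> 0" for m
    using that assms by (intro eval_mon_in_Api) (auto simp: restricted_ring_carrier_iff)
qed

lemma eval_series_cong:
  assumes "F \<in> carrier (restricted_ring \<pi> n r)" "\<And>\<mu>. \<mu> \<in> words n r \<Longrightarrow> x \<mu> = y \<mu>"
  shows "eval_series F x = eval_series F y"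
  unfolding eval_series_def
proof (rule infsum_cong)
  fix m
  have "eval_mon m x = eval_mon m y" if "F m \<noteq> 0"
  proof -
    have "Poly_Mapping.keys m \<subseteq> words n r"
      using that assms(1) by (simp add: restricted_ring_carrier_iff)
    then show ?thesis
      unfolding eval_mon_def using assms(2) by (intro prod.cong) (auto simp: subset_iff)
  qed
  then show "F m * eval_mon m x = F m * eval_mon m y" by (cases "F m = 0") auto
qed

end

section \<open>Expansion of the operators on a ball\<close>

sublocale eisenstein_root \<subseteq> compact_order \<pi>
  by unfold_locales (rule absv_pi_less_1, rule compact_Api)

locale frobenius_lifts = eisenstein_root p T \<pi> E
  for p :: nat and T :: "'a::nonarch_field itself" and \<pi> :: 'a and E :: "'a poly" +
  fixes n :: nat and \<phi> :: "nat \<Rightarrow> 'a \<Rightarrow> 'a"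
  assumes phi_hom: "i \<in> {1..n} \<Longrightarrow> \<phi> i \<in> ring_hom (ring_on (Api \<pi>)) (ring_on (Api \<pi>))"
    and phi_frobenius: "i \<in> {1..n} \<Longrightarrow> a \<in> Api \<pi> \<Longrightarrow> absv (\<phi> i a - a ^ p) < 1"
begin

lemma phi_in_Api: "i \<in> {1..n} \<Longrightarrow> a \<in> Api \<pi> \<Longrightarrow> \<phi> i a \<in> Api \<pi>"
  using ring_hom_closed[OF phi_hom] by simp

lemma phi_add: "i \<in> {1..n} \<Longrightarrow> a \<in> Api \<pi> \<Longrightarrow> b \<in> Api \<pi> \<Longrightarrow> \<phi> i (a + b) = \<phi> i a + \<phi> i b"
  using ring_hom_add[OF phi_hom] by (simp add: ring_of_type_algebra_def)

lemma phi_mult: "i \<in> {1..n} \<Longrightarrow> a \<in> Api \<pi> \<Longrightarrow> b \<in> Api \<pi> \<Longrightarrow> \<phi> i (a * b) = \<phi> i a * \<phi> i b"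
  using ring_hom_mult[OF phi_hom] by (simp add: ring_of_type_algebra_def)

lemma phi_1: "i \<in> {1..n} \<Longrightarrow> \<phi> i 1 = 1"
  using ring_hom_one[OF phi_hom] by (simp add: ring_of_type_algebra_def)

lemma phi_power: "i \<in> {1..n} \<Longrightarrow> a \<in> Api \<pi> \<Longrightarrow> \<phi> i (a ^ k) = \<phi> i a ^ k"
  by (induction k) (simp_all add: phi_1 phi_mult Api_power)

lemma phi_pi_multiple:
  assumes i: "i \<in> {1..n}"
  shows "\<exists>c\<in>Api \<pi>. \<phi> i \<pi> = \<pi> * c"
proof (rule Api_nonunit)
  show "\<phi> i \<pi> \<in> Api \<pi>" using i by (intro phi_in_Api pi_in_Api)
  have "absv \<pi> ^ p < 1" using absv_pi_less_1 p_gt_1 by (intro power_less_one_iff[THEN iffD2]) auto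
  then have "max (absv (\<phi> i \<pi> - \<pi> ^ p)) (absv (\<pi> ^ p)) < 1"
    using phi_frobenius[OF i pi_in_Api] by (simp add: absv_power)
  moreover have "absv (\<phi> i \<pi>) \<le> max (absv (\<phi> i \<pi> - \<pi> ^ p)) (absv (\<pi> ^ p))"
    using absv_add[of "\<phi> i \<pi> - \<pi> ^ p" "\<pi> ^ p"] by simp
  ultimately show "absv (\<phi> i \<pi>) < 1" by (rule le_less_trans[rotated])
qed

text \<open>The Frobenius congruence bounds the numerator by an absolute value below 1, which in the order means
  divisibility by \<open>\<pi>\<close>.\<close>

lemma delta1_in_Api:
  assumes "i \<in> {1..n}" "a \<in> Api \<pi>"
  shows "delta1 p \<pi> \<phi> i a \<in> Api \<pi>"
proof -
  have "\<phi> i a - a ^ p \<in> Api \<pi>" using assms by (intro Api_diff Api_power phi_in_Api)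
  then obtain b where "b \<in> Api \<pi>" "\<phi> i a - a ^ p = \<pi> * b"
    using Api_nonunit phi_frobenius[OF assms] by blast
  then show ?thesis using pi_nz by (simp add: delta1_def)
qed

lemma delta_word_in_Api: "set \<mu> \<subseteq> {1..n} \<Longrightarrow> a \<in> Api \<pi> \<Longrightarrow> delta_word p \<pi> \<phi> \<mu> a \<in> Api \<pi>"
  by (induction \<mu>) (auto simp: delta_word_def intro!: delta1_in_Api)

lemma phi_word_in_Api: "set \<mu> \<subseteq> {1..n} \<Longrightarrow> a \<in> Api \<pi> \<Longrightarrow> phi_word \<phi> \<mu> a \<in> Api \<pi>"
  by (induction \<mu>) (auto simp: phi_word_def intro!: phi_in_Api)

lemma phi_words_in_Api: "u \<in> Api \<pi> \<Longrightarrow> \<mu> \<in> words n r \<Longrightarrow> phi_word \<phi> \<mu> u \<in> Api \<pi>"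
  by (simp add: words_def phi_word_in_Api)

text \<open>The functions \<open>u \<mapsto> P(\<phi>\<^sub>\<nu>(u))\<close> with \<open>P\<close> an integral polynomial in the variables of words of length
  at most \<open>s\<close>. Generating them as a ring of functions avoids computing with the polynomials \<open>P\<close> in the
  recursion for \<open>\<delta>\<^sub>\<mu>\<close>.\<close>

inductive phi_poly :: "nat \<Rightarrow> ('a \<Rightarrow> 'a) \<Rightarrow> bool" for s
  where
    const: "c \<in> Api \<pi> \<Longrightarrow> phi_poly s (\<lambda>u. c)"
  | word: "\<nu> \<in> words n s \<Longrightarrow> phi_poly s (phi_word \<phi> \<nu>)"
  | add: "phi_poly s f \<Longrightarrow> phi_poly s g \<Longrightarrow> phi_poly s (\<lambda>u. f u + g u)"
  | mult: "phi_poly s f \<Longrightarrow> phi_poly s g \<Longrightarrow> phi_poly s (\<lambda>u. f u * g u)"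

lemma phi_poly_minus: "phi_poly s f \<Longrightarrow> phi_poly s (\<lambda>u. - f u)"
  using phi_poly.mult[OF phi_poly.const[OF Api_minus[OF one_in_Api]]] by simp

lemma phi_poly_diff: "phi_poly s f \<Longrightarrow> phi_poly s g \<Longrightarrow> phi_poly s (\<lambda>u. f u - g u)"
  using phi_poly.add[OF _ phi_poly_minus] by simp

lemma phi_poly_power: "phi_poly s f \<Longrightarrow> phi_poly s (\<lambda>u. f u ^ k)"
  by (induction k) (auto intro: phi_poly.const phi_poly.mult one_in_Api)

lemma phi_poly_sum: "(\<And>i. i \<in> I \<Longrightarrow> phi_poly s (f i)) \<Longrightarrow> phi_poly s (\<lambda>u. \<Sum>i\<in>I. f i u)"
  by (induction I rule: infinite_finite_induct) (auto intro: phi_poly.const phi_poly.add zero_in_Api)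

lemma phi_poly_in_Api: "phi_poly s f \<Longrightarrow> u \<in> Api \<pi> \<Longrightarrow> f u \<in> Api \<pi>"
  by (induction rule: phi_poly.induct)
    (auto intro: phi_words_in_Api Api_add Api_mult)

lemma phi_poly_Suc: "phi_poly s f \<Longrightarrow> phi_poly (Suc s) f"
  by (induction rule: phi_poly.induct) (auto simp: words_def intro: phi_poly.intros)

text \<open>Applying \<open>\<phi>\<^sub>i\<close> lengthens each word by one letter. Agreement is only on the order because \<open>\<phi>\<^sub>i\<close> is a
  homomorphism only there.\<close>

lemma phi_poly_compose:
  assumes "phi_poly s f" and i: "i \<in> {1..n}"
  shows "\<exists>h. phi_poly (Suc s) h \<and> (\<forall>u\<in>Api \<pi>. h u = \<phi> i (f u))"
  using assms(1)
proof (induction rule: phi_poly.induct)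
  case (const c)
  then have "\<phi> i c \<in> Api \<pi>" using i by (intro phi_in_Api)
  then show ?case by (intro exI[of _ "\<lambda>u. \<phi> i c"]) (simp add: phi_poly.const)
next
  case (word \<nu>)
  then have "phi_poly (Suc s) (phi_word \<phi> (i # \<nu>))"
    using i by (intro phi_poly.word) (auto simp: words_def)
  moreover have "phi_word \<phi> (i # \<nu>) u = \<phi> i (phi_word \<phi> \<nu> u)" for u
    by (simp add: phi_word_def)
  ultimately show ?case by blast
next
  case (add f g)
  then obtain h k where "phi_poly (Suc s) h" "\<forall>u\<in>Api \<pi>. h u = \<phi> i (f u)"
    "phi_poly (Suc s) k" "\<forall>u\<in>Api \<pi>. k u = \<phi> i (g u)" by blast
  then show ?case
    using add(1,2) phi_poly_in_Api phi_add[OF i]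
    by (intro exI[of _ "\<lambda>u. h u + k u"]) (simp add: phi_poly.add)
next
  case (mult f g)
  then obtain h k where "phi_poly (Suc s) h" "\<forall>u\<in>Api \<pi>. h u = \<phi> i (f u)"
    "phi_poly (Suc s) k" "\<forall>u\<in>Api \<pi>. k u = \<phi> i (g u)" by blast
  then show ?case
    using mult(1,2) phi_poly_in_Api phi_mult[OF i]
    by (intro exI[of _ "\<lambda>u. h u * k u"]) (simp add: phi_poly.mult)
qed

lemma phi_poly_representation:
  assumes "phi_poly r f"
  shows "\<exists>P\<in>polys_in (Api \<pi>) (words n r). \<forall>u. f u = poly_eval (\<lambda>\<mu>. phi_word \<phi> \<mu> u) P"
  using assms
proof (induction rule: phi_poly.induct)
  case (const c)
  then show ?case by (intro bexI[of _ "Poly_Mapping.single 0 c"] polys_in_single) auto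
next
  case (word \<nu>)
  have "poly_eval x (Poly_Mapping.single (Poly_Mapping.single \<nu> 1) 1) = x \<nu>" for x :: "nat list \<Rightarrow> 'a"
    unfolding poly_eval_single eval_mon_single by simp
  then show ?case
    using word by (intro bexI[of _ "Poly_Mapping.single (Poly_Mapping.single \<nu> 1) 1"] polys_in_single)
      (auto intro: one_in_Api)
next
  case (add f g)
  then show ?case by (metis poly_eval_add polys_in_add)
next
  case (mult f g)
  then show ?case by (metis poly_eval_mult polys_in_mult)
qed

text \<open>Each letter of a word costs one factor \<open>\<pi>\<close>: in the numerator of \<open>\<delta>\<^sub>i\<close> the variable part keeps
  the factor \<open>\<pi> ^ (r - s)\<close>, both after \<open>\<phi>\<^sub>i\<close>, since \<open>\<phi>\<^sub>i \<pi>\<close> is a multiple of \<open>\<pi>\<close>, and in the difference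
  of \<open>p\<close>-th powers.\<close>

lemma delta_word_expansion:
  assumes a: "a \<in> Api \<pi>"
  shows "set \<mu> \<subseteq> {1..n} \<Longrightarrow> length \<mu> \<le> r \<Longrightarrow>
    \<exists>f. phi_poly (length \<mu>) f \<and> (\<forall>u\<in>Api \<pi>. delta_word p \<pi> \<phi> \<mu> (a + \<pi> ^ r * u) =
      delta_word p \<pi> \<phi> \<mu> a + \<pi> ^ (r - length \<mu>) * f u)"
proof (induction \<mu>)
  case Nil
  have "phi_poly 0 (phi_word \<phi> [])" by (rule phi_poly.word) (simp add: words_def)
  moreover have "delta_word p \<pi> \<phi> [] (a + \<pi> ^ r * u) =
      delta_word p \<pi> \<phi> [] a + \<pi> ^ (r - length []) * phi_word \<phi> [] u" for u
    by (simp add: delta_word_def phi_word_def)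
  ultimately show ?case unfolding list.size by blast
next
  case (Cons i \<mu>)
  define s where "s = length \<mu>"
  define b where "b = delta_word p \<pi> \<phi> \<mu> a"
  define t where "t = \<pi> ^ (r - s)"
  have i: "i \<in> {1..n}" and \<mu>: "set \<mu> \<subseteq> {1..n}" "length \<mu> \<le> r" and sr: "Suc s \<le> r"
    using Cons.prems by (auto simp: s_def)
  obtain f where f: "phi_poly s f"
    "\<And>u. u \<in> Api \<pi> \<Longrightarrow> delta_word p \<pi> \<phi> \<mu> (a + \<pi> ^ r * u) = b + t * f u"
    using Cons.IH[OF \<mu>] unfolding s_def b_def t_def by blast
  obtain g where g: "phi_poly (Suc s) g" "\<forall>u\<in>Api \<pi>. g u = \<phi> i (f u)"
    using phi_poly_compose[OF f(1) i] by blast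
  obtain c where c: "c \<in> Api \<pi>" "\<phi> i \<pi> = \<pi> * c" using phi_pi_multiple[OF i] by blast
  obtain q where q: "p = Suc q" using p_gt_1 by (cases p) auto
  have b: "b \<in> Api \<pi>" unfolding b_def using \<mu>(1) a by (rule delta_word_in_Api)
  have t: "t \<in> Api \<pi>" unfolding t_def by (intro Api_power pi_in_Api)
  \<comment> \<open>The variable part of the numerator of \<open>\<delta>\<^sub>i\<close>, divided by \<open>\<pi> ^ (r - s)\<close>.\<close>
  define h where "h u = c ^ (r - s) * g u - f u * (\<Sum>j<Suc q. (b + t * f u) ^ j * b ^ (q - j))" for u
  have "phi_poly (Suc s) h"
    unfolding h_def
    by (intro phi_poly_diff phi_poly.mult phi_poly_sum phi_poly_power phi_poly.add g(1)
        phi_poly_Suc[OF f(1)] phi_poly.const Api_power c(1) b t)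
  moreover have "delta_word p \<pi> \<phi> (i # \<mu>) (a + \<pi> ^ r * u) =
      delta_word p \<pi> \<phi> (i # \<mu>) a + \<pi> ^ (r - Suc s) * h u" if u: "u \<in> Api \<pi>" for u
  proof -
    have fu: "f u \<in> Api \<pi>" using phi_poly_in_Api[OF f(1) u] .
    have "\<phi> i t = t * c ^ (r - s)"
      unfolding t_def using i by (simp add: phi_power pi_in_Api c(2) power_mult_distrib)
    then have "\<phi> i (b + t * f u) = \<phi> i b + t * c ^ (r - s) * g u"
      using i b t fu g(2) u by (simp add: phi_add phi_mult Api_mult)
    moreover have "(b + t * f u) ^ p = b ^ p + t * f u * (\<Sum>j<Suc q. (b + t * f u) ^ j * b ^ (q - j))"
      using diff_power_eq_sum[of "b + t * f u" q b] unfolding q by (simp add: algebra_simps)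
    ultimately have "\<phi> i (b + t * f u) - (b + t * f u) ^ p = (\<phi> i b - b ^ p) + t * h u"
      by (simp add: h_def algebra_simps)
    moreover have "t = \<pi> * \<pi> ^ (r - Suc s)"
      unfolding t_def using sr by (metis Suc_diff_le diff_Suc_Suc power_Suc)
    ultimately have "delta1 p \<pi> \<phi> i (b + t * f u) = delta1 p \<pi> \<phi> i b + \<pi> ^ (r - Suc s) * h u"
      using pi_nz by (simp add: delta1_def add_divide_distrib)
    then show ?thesis
      using f(2)[OF u] by (simp add: delta_word_def b_def)
  qed
  ultimately show ?case by (auto simp: s_def)
qed

text \<open>Analyticity asks for some restricted series on each ball, so polynomials of any shape in the
  \<open>\<phi>\<^sub>\<nu>(u)\<close> suffice.\<close>

lemma delta_words_polynomial:
  assumes a: "a \<in> Api \<pi>"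
  obtains g where "\<And>\<mu>. \<mu> \<in> words n r \<Longrightarrow> g \<mu> \<in> polys_in (Api \<pi>) (words n r)"
    and "\<And>\<mu> u. \<mu> \<in> words n r \<Longrightarrow> u \<in> Api \<pi> \<Longrightarrow>
      delta_word p \<pi> \<phi> \<mu> (a + \<pi> ^ r * u) = poly_eval (\<lambda>\<nu>. phi_word \<phi> \<nu> u) (g \<mu>)"
proof -
  have mono: "phi_poly t f" if "phi_poly s f" "s \<le> t" for s t f
    using that(2,1) by (induction rule: dec_induct) (auto intro: phi_poly_Suc)
  have "\<forall>\<mu>\<in>words n r. \<exists>P. P \<in> polys_in (Api \<pi>) (words n r) \<and> (\<forall>u\<in>Api \<pi>.
      delta_word p \<pi> \<phi> \<mu> (a + \<pi> ^ r * u) = poly_eval (\<lambda>\<nu>. phi_word \<phi> \<nu> u) P)"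
  proof
    fix \<mu>
    assume "\<mu> \<in> words n r"
    then have \<mu>: "set \<mu> \<subseteq> {1..n}" "length \<mu> \<le> r" by (auto simp: words_def)
    obtain f where f: "phi_poly (length \<mu>) f" "\<forall>u\<in>Api \<pi>. delta_word p \<pi> \<phi> \<mu> (a + \<pi> ^ r * u) =
        delta_word p \<pi> \<phi> \<mu> a + \<pi> ^ (r - length \<mu>) * f u"
      using delta_word_expansion[OF a \<mu>] by blast
    have "phi_poly r (\<lambda>u. delta_word p \<pi> \<phi> \<mu> a + \<pi> ^ (r - length \<mu>) * f u)"
      using mono[OF f(1) \<mu>(2)] delta_word_in_Api[OF \<mu>(1) a]
      by (intro phi_poly.add phi_poly.mult phi_poly.const Api_power pi_in_Api)
    from phi_poly_representation[OF this] show "\<exists>P. P \<in> polys_in (Api \<pi>) (words n r) \<and> (\<forall>u\<in>Api \<pi>.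
        delta_word p \<pi> \<phi> \<mu> (a + \<pi> ^ r * u) = poly_eval (\<lambda>\<nu>. phi_word \<phi> \<nu> u) P)"
      using f(2) by metis
  qed
  then show ?thesis using that by metis
qed

section \<open>Differential operators are analytic\<close>

lemma delta_words_in_Api: "u \<in> Api \<pi> \<Longrightarrow> \<mu> \<in> words n r \<Longrightarrow> delta_word p \<pi> \<phi> \<mu> u \<in> Api \<pi>"
  by (simp add: words_def delta_word_in_Api)

lemma ball_in_Api: "a \<in> Api \<pi> \<Longrightarrow> u \<in> Api \<pi> \<Longrightarrow> a + \<pi> ^ r * u \<in> Api \<pi>"
  by (intro Api_add Api_mult Api_power pi_in_Api)

text \<open>The same computation serves the explicit coefficients of \<open>\<tau>\<^sub>a\<close> and the polynomials from
  \<open>delta_words_polynomial\<close>.\<close>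

lemma Delta_on_ball:
  assumes G: "G \<in> carrier (restricted_ring \<pi> n r)" and a: "a \<in> Api \<pi>" and u: "u \<in> Api \<pi>"
    and g: "\<And>\<mu>. \<mu> \<in> words n r \<Longrightarrow> g \<mu> \<in> polys_in (Api \<pi>) (words n r)"
    and expansion: "\<And>\<mu>. \<mu> \<in> words n r \<Longrightarrow>
      delta_word p \<pi> \<phi> \<mu> (a + \<pi> ^ r * u) = poly_eval (\<lambda>\<nu>. phi_word \<phi> \<nu> u) (g \<mu>)"
  shows "Delta p \<pi> \<phi> G (a + \<pi> ^ r * u) = Phi \<pi> \<phi> (subst_series g G) u"
proof -
  have "Delta p \<pi> \<phi> G (a + \<pi> ^ r * u) = eval_series G (\<lambda>\<mu>. delta_word p \<pi> \<phi> \<mu> (a + \<pi> ^ r * u))"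
    using ball_in_Api[OF a u] by (simp add: Delta_def)
  also have "\<dots> = eval_series G (\<lambda>\<mu>. poly_eval (\<lambda>\<nu>. phi_word \<phi> \<nu> u) (g \<mu>))"
    by (rule eval_series_cong[OF G expansion])
  also have "\<dots> = eval_series (subst_series g G) (\<lambda>\<nu>. phi_word \<phi> \<nu> u)"
    using eval_series_subst_series[OF g G phi_words_in_Api[OF u]] by simp
  also have "\<dots> = Phi \<pi> \<phi> (subst_series g G) u"
    using u by (simp add: Phi_def)
  finally show ?thesis .
qed

lemma pdo_is_analytic:
  assumes "is_pdo p \<pi> n \<phi> r f"
  shows "is_analytic \<pi> n \<phi> r f"
proof -
  obtain G where G: "G \<in> carrier (restricted_ring \<pi> n r)" and f: "f = Delta p \<pi> \<phi> G"
    using assms by (auto simp: is_pdo_def)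
  have "\<exists>F\<in>carrier (restricted_ring \<pi> n r). \<forall>u\<in>Api \<pi>. f (a + \<pi> ^ r * u) = Phi \<pi> \<phi> F u"
    if a: "a \<in> Api \<pi>" for a
  proof -
    obtain g where g: "\<And>\<mu>. \<mu> \<in> words n r \<Longrightarrow> g \<mu> \<in> polys_in (Api \<pi>) (words n r)"
      and exp: "\<And>\<mu> u. \<mu> \<in> words n r \<Longrightarrow> u \<in> Api \<pi> \<Longrightarrow>
        delta_word p \<pi> \<phi> \<mu> (a + \<pi> ^ r * u) = poly_eval (\<lambda>\<nu>. phi_word \<phi> \<nu> u) (g \<mu>)"
      using delta_words_polynomial[OF a, of r] by blast
    have "\<forall>u\<in>Api \<pi>. f (a + \<pi> ^ r * u) = Phi \<pi> \<phi> (subst_series g G) u"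
    proof
      fix u
      assume u: "u \<in> Api \<pi>"
      show "f (a + \<pi> ^ r * u) = Phi \<pi> \<phi> (subst_series g G) u"
        unfolding f by (rule Delta_on_ball[OF G a u g exp[OF _ u]])
    qed
    then show ?thesis
      by (rule bexI[of _ "subst_series g G"]) (rule subst_series_carrier[OF g G])
  qed
  moreover have "f \<in> Api \<pi> \<rightarrow>\<^sub>E Api \<pi>"
    unfolding f Delta_def using eval_series_in_Api[OF G delta_words_in_Api] by auto
  ultimately show ?thesis by (simp add: is_analytic_def)
qed

lemma finite_subwords: "finite (subwords n r \<mu>)"
  by (rule finite_subset[OF _ finite_lists_length_le[of "{1..n}" r]]) (auto simp: subwords_def words_def)

lemma keys_J:
  assumes "\<mu> \<in> words n r" "j \<in> J p n r \<mu>"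
  shows "Poly_Mapping.keys j \<subseteq> subwords n r \<mu>"
  using assms by (auto simp: J_def subwords_def split: if_splits)

lemma tau_gen_in_polys:
  assumes "expansion_coeffs p \<pi> n \<phi> r c" "a \<in> Api \<pi>" and \<mu>: "\<mu> \<in> words n r"
  shows "tau_gen p n r c a \<mu> \<in> polys_in (Api \<pi>) (words n r)"
  unfolding tau_gen_def
proof (intro polys_in_sum polys_in_single)
  fix j
  assume j: "j \<in> J p n r \<mu>"
  then show "c a j \<mu> \<in> Api \<pi>" using assms by (auto simp: expansion_coeffs_def)
  show "Poly_Mapping.keys j \<subseteq> words n r"
    using keys_J[OF \<mu> j] by (auto simp: subwords_def)
qed

lemma delta_word_eq_tau_gen:
  assumes "expansion_coeffs p \<pi> n \<phi> r c" "a \<in> Api \<pi>" and \<mu>: "\<mu> \<in> words n r" and "u \<in> Api \<pi>"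
  shows "delta_word p \<pi> \<phi> \<mu> (a + \<pi> ^ r * u) =
    poly_eval (\<lambda>\<nu>. phi_word \<phi> \<nu> u) (tau_gen p n r c a \<mu>)"
proof -
  have "delta_word p \<pi> \<phi> \<mu> (a + \<pi> ^ r * u) = (\<Sum>j\<in>J p n r \<mu>. c a j \<mu> *
      (\<Prod>\<nu>\<in>subwords n r \<mu>. phi_word \<phi> \<nu> u ^ Poly_Mapping.lookup j \<nu>))"
    using assms by (simp add: expansion_coeffs_def)
  also have "\<dots> = (\<Sum>j\<in>J p n r \<mu>. c a j \<mu> * eval_mon j (\<lambda>\<nu>. phi_word \<phi> \<nu> u))"
    by (intro sum.cong refl) (simp add: eval_mon_superset[OF finite_subwords keys_J[OF \<mu>]])
  finally show ?thesis by (simp add: tau_gen_def poly_eval_sum)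
qed

lemma Delta_eq_Phi_oplus:
  assumes C: "is_centers \<pi> r C" and c: "expansion_coeffs p \<pi> n \<phi> r c"
    and F: "F \<in> carrier (restricted_ring \<pi> n r)"
  shows "Delta p \<pi> \<phi> F = Phi_oplus \<pi> \<phi> r C (\<lambda>a. tau p n r c a F)"
proof
  fix v
  show "Delta p \<pi> \<phi> F v = Phi_oplus \<pi> \<phi> r C (\<lambda>a. tau p n r c a F) v"
  proof (cases "v \<in> Api \<pi>")
    case v: True
    let ?Q = "\<lambda>(a, u). a \<in> C \<and> u \<in> Api \<pi> \<and> v = a + \<pi> ^ r * u"
    have "\<exists>!x. ?Q x" using C v by (simp add: is_centers_def)
    then have Q: "?Q (THE x. ?Q x)" by (rule theI')
    obtain a u where au: "(THE x. ?Q x) = (a, u)" by (cases "THE x. ?Q x")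
    then have "a \<in> C" and u: "u \<in> Api \<pi>" and va: "v = a + \<pi> ^ r * u" using Q by auto
    then have a: "a \<in> Api \<pi>" using C by (auto simp: is_centers_def)
    have "Phi_oplus \<pi> \<phi> r C (\<lambda>a. tau p n r c a F) v = Phi \<pi> \<phi> (tau p n r c a F) u"
      using v au by (simp add: Phi_oplus_def)
    also have "\<dots> = Delta p \<pi> \<phi> F v"
      unfolding va tau_def
      by (rule Delta_on_ball[OF F a u tau_gen_in_polys[OF c a] delta_word_eq_tau_gen[OF c a _ u], symmetric])
    finally show ?thesis by simp
  qed (simp add: Delta_def Phi_oplus_def)
qed

end

theorem theorem3p3:
  fixes p n r :: nat
    and \<pi> :: "'a::{nonarch_field, alg_closed_field}"
    and E :: "'a poly"
    and \<phi> :: "nat \<Rightarrow> 'a \<Rightarrow> 'a"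
  assumes "Factorial_Ring.prime p"
    and "is_K_alg p TYPE('a)"
    and "eisenstein p E" and "poly E \<pi> = 0"
    and "galois_ext (generate_field ring_of_type_algebra (Qp \<union> {\<pi>})) Qp"
    and "\<forall>i\<in>{1..n}. \<phi> i \<in> ring_hom (ring_on (Api \<pi>)) (ring_on (Api \<pi>)) \<and>
           (\<exists>\<sigma>. frobenius_aut p \<sigma> \<and> (\<forall>a\<in>Api \<pi>. \<phi> i a = \<sigma> a))"
  shows "(\<forall>f. is_pdo p \<pi> n \<phi> r f \<longrightarrow> is_analytic \<pi> n \<phi> r f) \<and>
    (\<forall>C c F. is_centers \<pi> r C \<longrightarrow> expansion_coeffs p \<pi> n \<phi> r c \<longrightarrow> F \<in> carrier (restricted_ring \<pi> n r) \<longrightarrow>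
      (\<forall>a\<in>C. restricted_alg_hom \<pi> n r (tau p n r c a) \<and>
         (\<forall>\<mu>\<in>words n r. tau p n r c a (var_series \<mu>) = Poly_Mapping.lookup (tau_gen p n r c a \<mu>))) \<and>
      Delta p \<pi> \<phi> F = Phi_oplus \<pi> \<phi> r C (\<lambda>a. tau p n r c a F))"
proof -
  interpret eisenstein_root p "TYPE('a)" \<pi> E
    using assms(1-4) by unfold_locales (auto simp: is_K_alg_def)
  interpret frobenius_lifts p "TYPE('a)" \<pi> E n \<phi>
  proof unfold_locales
    fix i a
    assume i: "i \<in> {1..n}"
    then show "\<phi> i \<in> ring_hom (ring_on (Api \<pi>)) (ring_on (Api \<pi>))" using assms(6) by blast
    assume a: "a \<in> Api \<pi>"
    obtain \<sigma> where "frobenius_aut p \<sigma>" "\<phi> i a = \<sigma> a" using assms(6) i a by blast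
    then show "absv (\<phi> i a - a ^ p) < 1"
      using absv_Api[OF a] by (simp add: frobenius_aut_def)
  qed
  show ?thesis
  proof (intro conjI allI impI ballI)
    fix f
    assume "is_pdo p \<pi> n \<phi> r f"
    then show "is_analytic \<pi> n \<phi> r f" by (rule pdo_is_analytic)
  next
    fix C c F
    assume C: "is_centers \<pi> r C" and c: "expansion_coeffs p \<pi> n \<phi> r c"
    {
      assume "F \<in> carrier (restricted_ring \<pi> n r)"
      then show "Delta p \<pi> \<phi> F = Phi_oplus \<pi> \<phi> r C (\<lambda>a. tau p n r c a F)"
        by (rule Delta_eq_Phi_oplus[OF C c])
    }
    fix a
    assume "a \<in> C"
    then have a: "a \<in> Api \<pi>" using C by (auto simp: is_centers_def)
    show "restricted_alg_hom \<pi> n r (tau p n r c a)"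
      unfolding tau_def by (rule restricted_alg_hom_subst_series[OF tau_gen_in_polys[OF c a]])
    fix \<mu>
    assume "\<mu> \<in> words n r"
    show "tau p n r c a (var_series \<mu>) = Poly_Mapping.lookup (tau_gen p n r c a \<mu>)"
      unfolding tau_def by (rule subst_series_var[OF tau_gen_in_polys[OF c a]])
  qed
qed

end
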